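(* Let $X=\{X_t:t\ge 0\}$ be a centered Lévy process such that $X_1$ belongs to the domain of attraction of a stable law with index $\alpha\in(1,2]$, in the sense that there exist a sequence $\{d(n)\}$ of positive numbers and an $\alpha$-stable Lévy process $\mathscr{L}^{(\alpha)}=\{\mathscr{L}^{(\alpha)}_t:t\ge0\}$ such that $$\frac{X_n}{d(n)}\xrightarrow{d}\mathscr{L}^{(\alpha)}_1\quad\text{as } n\to\infty.$$ For $a>0$, let $n(a)$ be a positive integer such that $$a\,n(a)\sim d(n(a))\quad\text{as } a\downarrow 0,$$ and set $\Delta(a)=1/d(n(a))$. Then $$\Delta(a)\,\sup_{t\ge0}(X_t-at)\xrightarrow{d}\sup_{t\ge 0}\left(\mathscr{L}^{(\alpha)}_t-t\right)\quad\text{as } a\downarrow 0.$$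
   Context: A Lévy process is a real-valued process with $X_0=0$, stationary independent increments (with respect to a standard filtration) and càdlàg paths; all Lévy processes considered are nondeterministic, i.e. $\sigma^2+\nu(\mathbb{R}\setminus\{0\})>0$, where $\sigma^2$ is the Gaussian coefficient and $\nu$ the Lévy measure. $X$ is centered if $\mathbb{E}X_t=0$ for all $t$. An $\alpha$-stable Lévy process $\mathscr{L}^{(\alpha)}$ is a Lévy process whose value at time $1$ has a stable distribution with index $\alpha$. $f(a)\sim g(a)$ as $a\downarrow0$ means $f(a)/g(a)\to1$. $\xrightarrow{d}$ denotes convergence in distribution. *)

theory Defs
  imports "HOL-Probability.Probability"
begin

text \<open>
  Time is \<open>[0, \<infinity>)\<close>, embedded in type \<^typ>\<open>real\<close>; only the values of a process at times
  \<open>t \<ge> 0\<close> matter. The library locale \<^locale>\<open>filtration\<close> is indexed by the whole type, which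
  is harmless because a filtration on \<open>[0, \<infinity>)\<close> extends by \<open>F t = F 0\<close> for \<open>t < 0\<close>.
  The last two assumptions and completeness of \<open>M\<close> are the usual conditions.
\<close>

locale standard_filtration = prob_space M + complete_measure M + filtration "space M" F
  for M :: "'a measure" and F :: "real \<Rightarrow> 'a measure" +
  assumes sets_F_subset: "\<And>t. sets (F t) \<subseteq> sets M"
    and null_sets_F: "null_sets M \<subseteq> sets (F 0)"
    and right_continuous_F: "\<And>t. 0 \<le> t \<Longrightarrow> sets (F t) = (\<Inter>s\<in>{t<..}. sets (F s))"

definition cadlag :: "(real \<Rightarrow> real) \<Rightarrow> bool" where
  "cadlag x \<longleftrightarrow>
     (\<forall>t\<ge>0. continuous (at_right t) x) \<and> (\<forall>t>0. \<exists>l. (x \<longlongrightarrow> l) (at_left t))"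

definition levy_measure :: "real measure \<Rightarrow> bool" where
  "levy_measure \<nu> \<longleftrightarrow> sets \<nu> = sets borel \<and> emeasure \<nu> {0} = 0 \<and>
     (\<integral>\<^sup>+x. ennreal (min 1 (x\<^sup>2)) \<partial>\<nu>) < \<infinity>"

text \<open>
  The Levy--Khintchine exponent with drift \<open>b\<close>, Gaussian coefficient \<open>v\<close> (that is,
  \<open>\<sigma>\<^sup>2\<close>), Levy measure \<open>\<nu>\<close> and truncation function \<open>x 1{\<bar>x\<bar> \<le> 1}\<close>.
\<close>

definition levy_exponent :: "real \<Rightarrow> real \<Rightarrow> real measure \<Rightarrow> real \<Rightarrow> complex" where
  "levy_exponent b v \<nu> u =
     \<i> * of_real (b * u) - of_real (v * u\<^sup>2 / 2) +
     (CLINT x|\<nu>. iexp (u * x) - 1 - \<i> * of_real (u * x * indicator {-1..1} x))"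

definition has_levy_triplet ::
  "'a measure \<Rightarrow> (real \<Rightarrow> 'a \<Rightarrow> real) \<Rightarrow> real \<Rightarrow> real \<Rightarrow> real measure \<Rightarrow> bool" where
  "has_levy_triplet M X b v \<nu> \<longleftrightarrow> 0 \<le> v \<and> levy_measure \<nu> \<and>
     (\<forall>t\<ge>0. \<forall>u. char (distr M borel (X t)) u = exp (of_real t * levy_exponent b v \<nu> u))"

text \<open>
  Every Levy process has exactly one triplet, so the existential quantifier below merely
  names its Gaussian coefficient and its Levy measure.
\<close>

definition nondeterministic :: "'a measure \<Rightarrow> (real \<Rightarrow> 'a \<Rightarrow> real) \<Rightarrow> bool" where
  "nondeterministic M X \<longleftrightarrow>
     (\<exists>b v \<nu>. has_levy_triplet M X b v \<nu> \<and> ennreal v + emeasure \<nu> (UNIV - {0}) > 0)"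

locale levy_process = standard_filtration M F
  for M :: "'a measure" and F :: "real \<Rightarrow> 'a measure" +
  fixes X :: "real \<Rightarrow> 'a \<Rightarrow> real"
  assumes adapted: "\<And>t. 0 \<le> t \<Longrightarrow> X t \<in> borel_measurable (F t)"
    and start_zero: "\<And>\<omega>. \<omega> \<in> space M \<Longrightarrow> X 0 \<omega> = 0"
    and cadlag_paths: "\<And>\<omega>. \<omega> \<in> space M \<Longrightarrow> cadlag (\<lambda>t. X t \<omega>)"
    and stationary_increments: "\<And>s t. 0 \<le> s \<Longrightarrow> s \<le> t \<Longrightarrow>
      distr M borel (\<lambda>\<omega>. X t \<omega> - X s \<omega>) = distr M borel (X (t - s))"
    and independent_increments: "\<And>s t. 0 \<le> s \<Longrightarrow> s \<le> t \<Longrightarrow>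
      indep_set (sets (F s)) {(\<lambda>\<omega>. X t \<omega> - X s \<omega>) -` B \<inter> space M | B. B \<in> sets borel}"
    and nondeterministic: "nondeterministic M X"

definition centered :: "'a measure \<Rightarrow> (real \<Rightarrow> 'a \<Rightarrow> real) \<Rightarrow> bool" where
  "centered M X \<longleftrightarrow> (\<forall>t\<ge>0. integrable M (X t) \<and> (\<integral>\<omega>. X t \<omega> \<partial>M) = 0)"

text \<open>
  A nondegenerate law is stable with index \<open>\<alpha>\<close> if, for independent \<open>Y\<close> and \<open>Z\<close> with this law
  and all \<open>A, B > 0\<close>, the sum \<open>A Y + B Z\<close> has the law of \<open>C Y + D\<close> for some \<open>D\<close>, where
  \<open>C\<^sup>\<alpha> = A\<^sup>\<alpha> + B\<^sup>\<alpha>\<close>. Point masses satisfy this relation for every \<open>\<alpha>\<close>, hence have no index.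
\<close>

definition stable_law :: "real \<Rightarrow> real measure \<Rightarrow> bool" where
  "stable_law \<alpha> \<mu> \<longleftrightarrow> 0 < \<alpha> \<and> \<alpha> \<le> 2 \<and> real_distribution \<mu> \<and> \<not> (\<exists>c. AE x in \<mu>. x = c) \<and>
     (\<forall>A>0. \<forall>B>0. \<exists>D.
        distr (\<mu> \<Otimes>\<^sub>M \<mu>) borel (\<lambda>(y, z). A * y + B * z) =
        distr \<mu> borel (\<lambda>y. (A powr \<alpha> + B powr \<alpha>) powr (1 / \<alpha>) * y + D))"

locale stable_levy_process = levy_process M F L
  for M :: "'a measure" and F :: "real \<Rightarrow> 'a measure" and L :: "real \<Rightarrow> 'a \<Rightarrow> real" +
  fixes \<alpha> :: real
  assumes stable: "stable_law \<alpha> (distr M borel (L 1))"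

text \<open>\<^const>\<open>weak_conv_m\<close> is the case \<open>G = sequentially\<close>.\<close>

definition weak_conv_along :: "('i \<Rightarrow> real measure) \<Rightarrow> real measure \<Rightarrow> 'i filter \<Rightarrow> bool" where
  "weak_conv_along \<mu> \<nu> G \<longleftrightarrow>
     (\<forall>x. isCont (cdf \<nu>) x \<longrightarrow> ((\<lambda>i. cdf (\<mu> i) x) \<longlongrightarrow> cdf \<nu> x) G)"

end

theory Submission
  imports Defs
begin

text \<open>
  Why the theorem is true. Put \<open>n = n a\<close> and \<open>c = a n / d n\<close>, so that \<open>c \<rightarrow> 1\<close>. Rescaling time by
  \<open>n\<close> turns \<open>\<Delta> a * sup (X t - a t)\<close> into the supremum over \<open>t \<ge> 0\<close> of the process
  \<open>X (n t) / d n - c t\<close>, and the increments of this process over a fixed time step converge in law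
  to those of \<open>L t - t\<close>. It remains to exchange a limit in law with a supremum over a half line.
  Everything is phrased through the probability that a process crosses a level \<open>x\<close>, that is, of the
  event that it exceeds \<open>x\<close> at some time.

  On a finite grid of times the crossing probabilities converge because the increments are independent
  (\<open>partial_sums_weak_conv\<close>). Passing from a grid to a whole interval needs no functional limit
  theorem: at the first time a level is exceeded, the process is unlikely to drop noticeably before
  the next grid point, since it has a fresh start and little time. This is Ottaviani's inequality
  (\<open>Ottaviani\<close>), and it loses only a factor and a shift of the level that are uniform in \<open>n\<close>.

  The half line is the heart of the matter: one must rule out that \<open>X (n t) / d n\<close> catches up with
  \<open>t / 2\<close> at some very late time, uniformly in \<open>n\<close> (\<open>far_tail\<close>). Two facts carry this. The first is
  \<open>doubling\<close>: \<open>d (2 n) \<le> 2 powr \<beta> * d n\<close> for large \<open>n\<close> and some \<open>\<beta> < 1\<close>, which holds because the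
  stable limit scales with the exponent \<open>1 / \<alpha> < 1\<close>. The second is \<open>power_tail\<close>:
  \<open>\<bar>X n\<bar> > y d n\<close> has probability at most a multiple of \<open>y powr (- 1 / \<beta>)\<close>, uniformly in \<open>n\<close>. For if
  \<open>X n\<close> were of size \<open>d (2 ^ k * n)\<close> with probability well above \<open>1 / 2 ^ k\<close>, one of the \<open>2 ^ k\<close>
  independent blocks that make up \<open>X (2 ^ k * n)\<close> would typically be that large, against the tightness
  of \<open>X (2 ^ k * n) / d (2 ^ k * n)\<close>. Since \<open>d (2 ^ j * n)\<close> grows slower than the barrier
  \<open>2 ^ j * d n / 2\<close>, the probabilities of crossing it during \<open>[2 ^ j, 2 ^ (j + 1)]\<close> are dominated by
  a geometric series.
\<close>

section \<open>Characteristic exponents and weak convergence\<close>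

lemma levy_integrand_bound:
  fixes u x :: real
  shows "cmod (iexp (u * x) - 1 - \<i> * of_real (u * x * indicator {-1..1} x))
    \<le> (2 + u\<^sup>2) * min 1 (x\<^sup>2)"
proof (cases "\<bar>x\<bar> \<le> 1")
  case True
  then have "x \<in> {-1..1}" "x\<^sup>2 \<le> 1" by (auto simp: abs_le_iff power2_le_iff_abs_le abs_square_le_1)
  have "cmod (iexp (u * x) - (\<Sum>k\<le>1. (\<i> * of_real (u * x)) ^ k / fact k)) \<le> \<bar>u * x\<bar> ^ Suc 1 / fact (Suc 1)"
    by (rule iexp_approx1)
  then have "cmod (iexp (u * x) - 1 - \<i> * of_real (u * x)) \<le> (u * x)\<^sup>2 / 2"
    by (simp add: power2_eq_square abs_mult diff_diff_eq mult.assoc)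
  also have "\<dots> \<le> (2 + u\<^sup>2) * x\<^sup>2"
    by (simp add: power_mult_distrib algebra_simps)
  finally show ?thesis using \<open>x \<in> _\<close> \<open>x\<^sup>2 \<le> 1\<close> by simp
next
  case False
  then have "x \<notin> {-1..1}" by auto
  have "1 \<le> x\<^sup>2" using False by (metis abs_le_square_iff abs_one linear one_power2)
  have "cmod (iexp (u * x) - 1) \<le> cmod (iexp (u * x)) + cmod 1" by (rule norm_triangle_ineq4)
  also have "\<dots> \<le> 2 + u\<^sup>2" by simp
  finally show ?thesis using \<open>x \<notin> _\<close> \<open>1 \<le> x\<^sup>2\<close> by simp
qed

lemma levy_exponent_0: "levy_exponent b v \<nu> 0 = 0"
  by (simp add: levy_exponent_def)

lemma continuous_levy_exponent:
  assumes "levy_measure \<nu>"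
  shows "continuous_on UNIV (levy_exponent b v \<nu>)"
proof -
  define h where "h u x = iexp (u * x) - 1 - \<i> * of_real (u * x * indicator {-1..1} x)" for u x :: real
  have [measurable_cong]: "sets \<nu> = sets borel" using assms by (simp add: levy_measure_def)
  have [measurable]: "h u \<in> borel_measurable \<nu>" for u unfolding h_def by measurable
  have int: "integrable \<nu> (\<lambda>x. min 1 (x\<^sup>2) :: real)"
    using assms by (intro integrableI_nonneg) (auto simp: levy_measure_def)
  have "continuous_on UNIV (\<lambda>u. CLINT x|\<nu>. h u x)"
    unfolding continuous_on_sequentially
  proof (intro allI ballI impI, elim conjE)
    fix w :: "nat \<Rightarrow> real" and u assume w: "w \<longlonglongrightarrow> u"
    then have "Bseq w" using convergentI convergent_imp_Bseq by blast
    then obtain K where K: "0 < K" "\<And>n. \<bar>w n\<bar> \<le> K" by (auto simp: Bseq_def)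
    show "((\<lambda>u. CLINT x|\<nu>. h u x) \<circ> w) \<longlonglongrightarrow> (CLINT x|\<nu>. h u x)"
      unfolding comp_def
    proof (rule integral_dominated_convergence[where w="\<lambda>x. (2 + K\<^sup>2) * min 1 (x\<^sup>2)"])
      show "AE x in \<nu>. (\<lambda>n. h (w n) x) \<longlonglongrightarrow> h u x"
        unfolding h_def by (intro AE_I2 tendsto_intros w)
      show "AE x in \<nu>. cmod (h (w n) x) \<le> (2 + K\<^sup>2) * min 1 (x\<^sup>2)" for n
      proof (intro AE_I2)
        fix x :: real
        have "(w n)\<^sup>2 \<le> K\<^sup>2" using K(2)[of n] K(1) by (simp add: abs_le_square_iff[symmetric])
        then show "cmod (h (w n) x) \<le> (2 + K\<^sup>2) * min 1 (x\<^sup>2)"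
          using levy_integrand_bound[of "w n" x] unfolding h_def
          by (elim order_trans) (intro mult_right_mono, auto)
      qed
    qed (use int in auto)
  qed
  then show ?thesis
    unfolding levy_exponent_def h_def by (intro continuous_intros) auto
qed

text \<open>
  Exponents are determined by their exponentials only up to a multiple of \<open>2 \<pi> \<i>\<close>. Here the two
  sides are continuous and agree at \<open>0\<close>, and the quotient of the exponentials stays in the right half
  plane, so the multiple cannot jump and is \<open>0\<close> throughout.
\<close>

lemma uniform_limit_of_exp:
  fixes f :: "nat \<Rightarrow> real \<Rightarrow> complex" and g :: "real \<Rightarrow> complex"
  assumes "0 \<le> K" and f: "\<And>n. continuous_on {-K..K} (f n)" "\<And>n. f n 0 = 0"
    and g: "continuous_on {-K..K} g" "g 0 = 0"
    and lim: "uniform_limit {-K..K} (\<lambda>n u. exp (f n u)) (\<lambda>u. exp (g u)) sequentially"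
  shows "uniform_limit {-K..K} f g sequentially"
proof (rule uniform_limitI)
  fix e :: real assume "0 < e"
  have "isCont Ln 1" by (intro continuous_at_Ln) auto
  then obtain \<eta> where \<eta>: "0 < \<eta>" "\<And>w. dist w 1 < \<eta> \<Longrightarrow> dist (Ln w) (Ln 1) < e"
    using \<open>0 < e\<close> unfolding continuous_at_eps_delta by blast
  have "compact ((\<lambda>u. exp (- g u)) ` {-K..K})"
    using g by (intro compact_continuous_image continuous_intros) auto
  then obtain B where B: "0 < B" "\<And>u. u \<in> {-K..K} \<Longrightarrow> cmod (exp (- g u)) \<le> B"
    by (metis compact_imp_bounded bounded_pos image_eqI)
  have "0 < min \<eta> 1 / B" using \<eta> B by simp
  from uniform_limitD[OF lim this]
  show "\<forall>\<^sub>F n in sequentially. \<forall>u\<in>{-K..K}. dist (f n u) (g u) < e"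
  proof eventually_elim
    case (elim n)
    \<comment> \<open>\<open>q\<close> is the quotient of the two exponentials; it is close to \<open>1\<close>\<close>
    define q where "q u = exp (f n u - g u)" for u
    have q1: "dist (q u) 1 < min \<eta> 1" if u: "u \<in> {-K..K}" for u
    proof -
      have "q u - 1 = exp (- g u) * (exp (f n u) - exp (g u))"
        by (simp add: q_def right_diff_distrib exp_minus_inverse exp_diff exp_minus field_simps)
      then have "dist (q u) 1 = cmod (exp (- g u)) * dist (exp (f n u)) (exp (g u))"
        by (simp add: dist_norm norm_mult)
      also have "\<dots> \<le> B * dist (exp (f n u)) (exp (g u))"
        using B u by (intro mult_right_mono) auto
      also have "\<dots> < B * (min \<eta> 1 / B)"
        using elim u B by (intro mult_strict_left_mono) auto
      finally show ?thesis using B by simp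
    qed
    have Req: "0 < Re (q u)" if "u \<in> {-K..K}" for u
    proof -
      have "\<bar>Re (q u - 1)\<bar> < 1" using q1[OF that] abs_Re_le_cmod[of "q u - 1"] by (auto simp: dist_norm)
      then show ?thesis by simp
    qed
    have cq: "continuous_on {-K..K} (\<lambda>u. Ln (q u))"
      unfolding q_def using f g Req
      by (intro continuous_intros) (auto simp: q_def complex_nonpos_Reals_iff not_le dest!: Req)
    have "(\<lambda>u. f n u - g u - Ln (q u)) constant_on {-K..K}"
    proof (rule continuous_discrete_range_constant)
      show "connected {-K..K}" by simp
      show "continuous_on {-K..K} (\<lambda>u. f n u - g u - Ln (q u))"
        using f g cq by (intro continuous_on_diff)
      fix u assume u: "u \<in> {-K..K}"
      have per: "\<exists>k::int. f n v - g v - Ln (q v) = of_int k * (2 * pi * \<i>)" for v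
      proof -
        have "exp (f n v - g v) = exp (Ln (q v))" by (simp add: q_def)
        then obtain k :: int where "f n v - g v = Ln (q v) + of_int (2 * k) * pi * \<i>"
          unfolding exp_eq by auto
        then show ?thesis by (intro exI[of _ k]) (simp add: algebra_simps)
      qed
      show "\<exists>e>0. \<forall>y. y \<in> {-K..K} \<and> f n y - g y - Ln (q y) \<noteq> f n u - g u - Ln (q u) \<longrightarrow>
          e \<le> cmod (f n y - g y - Ln (q y) - (f n u - g u - Ln (q u)))"
      proof (intro exI[of _ 1] conjI allI impI, goal_cases)
        case (2 y)
        obtain k l :: int where kl: "f n y - g y - Ln (q y) = of_int k * (2 * pi * \<i>)"
          "f n u - g u - Ln (q u) = of_int l * (2 * pi * \<i>)" using per by metis
        then have "k \<noteq> l" using 2 by auto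
        have "f n y - g y - Ln (q y) - (f n u - g u - Ln (q u)) = of_int (k - l) * (2 * pi * \<i>)"
          unfolding kl by (simp add: algebra_simps)
        then have "cmod (f n y - g y - Ln (q y) - (f n u - g u - Ln (q u))) = \<bar>of_int (k - l)\<bar> * (2 * pi)"
          by (simp add: norm_mult del: of_int_diff)
        moreover have "1 \<le> \<bar>real_of_int (k - l)\<bar>" using \<open>k \<noteq> l\<close> by linarith
        then have "1 * 1 \<le> \<bar>real_of_int (k - l)\<bar> * (2 * pi)"
          using pi_gt3 by (intro mult_mono) auto
        ultimately show ?case by simp
      qed simp
    qed
    then obtain c where c: "\<And>u. u \<in> {-K..K} \<Longrightarrow> f n u - g u - Ln (q u) = c"
      unfolding constant_on_def by blast
    have "c = 0" using c[of 0] \<open>0 \<le> K\<close> f g by (simp add: q_def)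
    show ?case
    proof
      fix u assume u: "u \<in> {-K..K}"
      have "f n u - g u = Ln (q u)" using c[OF u] \<open>c = 0\<close> by simp
      moreover have "dist (Ln (q u)) (Ln 1) < e" using q1[OF u] by (intro \<eta>) auto
      ultimately show "dist (f n u) (g u) < e" by (simp add: dist_norm)
    qed
  qed
qed

text \<open>
  With Skorohod's almost surely convergent copies, the two characteristic functions at \<open>u\<close> differ by
  at most the mean of \<open>min 2 (\<bar>u\<bar> * \<bar>Y_seq n - Y\<bar>)\<close>, a bound that is uniform for bounded \<open>u\<close>.
\<close>

lemma uniform_limit_char:
  assumes \<mu>: "\<And>n. real_distribution (\<mu> n)" and \<mu>': "real_distribution \<mu>'" and w: "weak_conv_m \<mu> \<mu>'"
  shows "uniform_limit {-K..K} (\<lambda>n. char (\<mu> n)) (char \<mu>') sequentially"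
proof -
  obtain \<Omega> :: "real measure" and Y_seq :: "nat \<Rightarrow> real \<Rightarrow> real" and Y :: "real \<Rightarrow> real"
    where \<Omega>: "prob_space \<Omega>" and Y_seq: "\<And>n. Y_seq n \<in> measurable \<Omega> borel"
      "\<And>n. distr \<Omega> borel (Y_seq n) = \<mu> n" and Y': "Y \<in> measurable \<Omega> lborel" and Yd: "distr \<Omega> borel Y = \<mu>'"
      and conv: "\<And>x. x \<in> space \<Omega> \<Longrightarrow> (\<lambda>n. Y_seq n x) \<longlonglongrightarrow> Y x"
    using Skorohod[OF \<mu> \<mu>' w] by blast
  interpret \<Omega>: prob_space \<Omega> by fact
  note [measurable] = Y_seq(1)
  have [measurable]: "Y \<in> borel_measurable \<Omega>" using Y' by simp
  define D where "D n = (\<integral>x. min 2 (\<bar>K\<bar> * \<bar>Y_seq n x - Y x\<bar>) \<partial>\<Omega>)" for n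
  have "D \<longlonglongrightarrow> (\<integral>x. 0 \<partial>\<Omega>)"
    unfolding D_def
  proof (rule integral_dominated_convergence[where w="\<lambda>_. 2"])
    show "AE x in \<Omega>. (\<lambda>n. min 2 (\<bar>K\<bar> * \<bar>Y_seq n x - Y x\<bar>)) \<longlonglongrightarrow> 0"
    proof (intro AE_I2)
      fix x assume "x \<in> space \<Omega>"
      then have "(\<lambda>n. min 2 (\<bar>K\<bar> * \<bar>Y_seq n x - Y x\<bar>)) \<longlonglongrightarrow> min 2 (\<bar>K\<bar> * \<bar>Y x - Y x\<bar>)"
        by (intro tendsto_intros conv)
      then show "(\<lambda>n. min 2 (\<bar>K\<bar> * \<bar>Y_seq n x - Y x\<bar>)) \<longlonglongrightarrow> 0" by simp
    qed
  qed auto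
  then have D0: "D \<longlonglongrightarrow> 0" by simp
  have bound: "cmod (char (\<mu> n) u - char \<mu>' u) \<le> D n" if "u \<in> {-K..K}" for n u
  proof -
    have i: "integrable \<Omega> (\<lambda>x. iexp (u * Y_seq n x))" "integrable \<Omega> (\<lambda>x. iexp (u * Y x))"
      by (auto intro!: \<Omega>.integrable_iexp)
    have "char (\<mu> n) u - char \<mu>' u = (CLINT x|\<Omega>. iexp (u * Y_seq n x) - iexp (u * Y x))"
      unfolding char_def Y_seq(2)[symmetric] Yd[symmetric]
      using i by (simp add: integral_distr)
    also have "cmod \<dots> \<le> (\<integral>x. cmod (iexp (u * Y_seq n x) - iexp (u * Y x)) \<partial>\<Omega>)"
      by (rule integral_norm_bound)
    also have "\<dots> \<le> D n"
      unfolding D_def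
    proof (rule integral_mono)
      show "integrable \<Omega> (\<lambda>x. min 2 (\<bar>K\<bar> * \<bar>Y_seq n x - Y x\<bar>))"
        by (rule \<Omega>.integrable_const_bound[of _ 2]) auto
      fix x assume "x \<in> space \<Omega>"
      have 1: "cmod (iexp a - 1) \<le> \<bar>a\<bar>" for a
        using iexp_approx1[of a 0] by simp
      have "iexp (u * Y_seq n x) - iexp (u * Y x) = iexp (u * Y x) * (iexp (u * (Y_seq n x - Y x)) - 1)"
        by (simp add: right_diff_distrib exp_diff field_simps)
      then have "cmod (iexp (u * Y_seq n x) - iexp (u * Y x)) = cmod (iexp (u * (Y_seq n x - Y x)) - 1)"
        by (simp add: norm_mult del: of_real_mult)
      also have "\<dots> \<le> \<bar>u * (Y_seq n x - Y x)\<bar>" by (rule 1)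
      also have "\<dots> \<le> \<bar>K\<bar> * \<bar>Y_seq n x - Y x\<bar>"
        using that by (auto simp: abs_mult intro!: mult_right_mono)
      finally have "cmod (iexp (u * Y_seq n x) - iexp (u * Y x)) \<le> \<bar>K\<bar> * \<bar>Y_seq n x - Y x\<bar>" .
      moreover have "cmod (iexp (u * Y_seq n x) - iexp (u * Y x)) \<le> 2"
        using norm_triangle_ineq4[of "iexp (u * Y_seq n x)" "iexp (u * Y x)"] by simp
      ultimately show "cmod (iexp (u * Y_seq n x) - iexp (u * Y x)) \<le> min 2 (\<bar>K\<bar> * \<bar>Y_seq n x - Y x\<bar>)" by simp
    qed (use i in auto)
    finally show ?thesis .
  qed
  show ?thesis
  proof (rule uniform_limitI)
    fix e :: real assume "0 < e"
    from order_tendstoD(2)[OF D0 this]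
    show "\<forall>\<^sub>F n in sequentially. \<forall>u\<in>{-K..K}. dist (char (\<mu> n) u) (char \<mu>' u) < e"
      by eventually_elim (use bound in \<open>fastforce simp: dist_norm intro: le_less_trans\<close>)
  qed
qed

lemma (in prob_space) convergence_in_probability_of_AE:
  fixes Z :: "nat \<Rightarrow> 'a \<Rightarrow> real"
  assumes [measurable]: "\<And>k. Z k \<in> borel_measurable M" "Z' \<in> borel_measurable M"
    and conv: "AE \<omega> in M. (\<lambda>k. Z k \<omega>) \<longlonglongrightarrow> Z' \<omega>" and "0 < e"
  shows "(\<lambda>k. \<P>(\<omega> in M. e < \<bar>Z k \<omega> - Z' \<omega>\<bar>)) \<longlonglongrightarrow> 0"
proof -
  have "(\<lambda>k. \<integral>\<omega>. indicator {\<omega>\<in>space M. e < \<bar>Z k \<omega> - Z' \<omega>\<bar>} \<omega> \<partial>M) \<longlonglongrightarrow> (\<integral>\<omega>. (0::real) \<partial>M)"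
  proof (rule integral_dominated_convergence[where w="\<lambda>_. 1"])
    show "AE \<omega> in M. (\<lambda>k. indicator {\<omega>\<in>space M. e < \<bar>Z k \<omega> - Z' \<omega>\<bar>} \<omega> :: real) \<longlonglongrightarrow> 0"
      using conv
    proof eventually_elim
      case (elim \<omega>)
      have "\<forall>\<^sub>F k in sequentially. dist (Z k \<omega>) (Z' \<omega>) < e"
        using elim \<open>0 < e\<close> by (rule tendstoD)
      then show ?case
        by (intro tendsto_eventually) (auto elim!: eventually_mono simp: dist_real_def)
    qed
  qed auto
  then show ?thesis by simp
qed

lemma concentration_if_char_tendsto_1:
  assumes \<mu>: "\<And>k. real_distribution (\<mu> k)" and c: "\<And>u. (\<lambda>k. char (\<mu> k) u) \<longlonglongrightarrow> 1" and "0 < e"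
  shows "(\<lambda>k. measure (\<mu> k) {x. e < \<bar>x\<bar>}) \<longlonglongrightarrow> 0"
proof -
  define \<mu>' where "\<mu>' = return borel (0::real)"
  have \<mu>': "real_distribution \<mu>'"
    unfolding \<mu>'_def by (simp add: real_distribution_def real_distribution_axioms_def prob_space_return)
  have "char \<mu>' u = 1" for u
    unfolding char_def \<mu>'_def by (subst integral_return) auto
  then have w: "weak_conv_m \<mu> \<mu>'"
    using c by (intro levy_continuity \<mu> \<mu>') simp
  have "(\<lambda>k. measure (\<mu> k) {x. e < \<bar>x\<bar>}) \<longlonglongrightarrow> measure \<mu>' {x. e < \<bar>x\<bar>}"
  proof (rule weak_conv_imp_continuity_set_conv[OF \<mu> \<mu>' w])
    have "open {x::real. e < \<bar>x\<bar>}" by (intro open_Collect_less continuous_intros)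
    have cl: "closed {x::real. e \<le> \<bar>x\<bar>}" by (intro closed_Collect_le continuous_intros)
    have "frontier {x::real. e < \<bar>x\<bar>} \<subseteq> {x. e \<le> \<bar>x\<bar>}"
      unfolding frontier_def using closure_minimal[OF _ cl, of "{x. e < \<bar>x\<bar>}"] by force
    then have "0 \<notin> frontier {x::real. e < \<bar>x\<bar>}" using \<open>0 < e\<close> by auto
    then show "emeasure \<mu>' (frontier {x. e < \<bar>x\<bar>}) = 0"
      unfolding \<mu>'_def by (subst emeasure_return) (auto simp: frontier_def)
    show "{x::real. e < \<bar>x\<bar>} \<in> sets borel" by measurable
  qed
  moreover have "measure \<mu>' {x. e < \<bar>x\<bar>} = 0"
    using \<open>0 < e\<close> unfolding \<mu>'_def by (subst measure_return) auto
  ultimately show ?thesis by simp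
qed

text \<open>
  The squared modulus of a characteristic function belongs to the difference of two independent
  copies, which is therefore \<open>0\<close> almost surely.
\<close>

lemma AE_const_if_cmod_char_eq_1:
  assumes "real_distribution \<mu>" and one: "\<And>u. cmod (char \<mu> u) = 1"
  shows "\<exists>c. AE x in \<mu>. x = c"
proof -
  interpret \<mu>: real_distribution \<mu> by fact
  interpret P: pair_prob_space \<mu> \<mu> by unfold_locales
  define \<rho> where "\<rho> = distr (\<mu> \<Otimes>\<^sub>M \<mu>) borel (\<lambda>p. fst p - snd p)"
  have \<rho>: "real_distribution \<rho>"
    unfolding \<rho>_def by (intro P.real_distribution_distr) measurable
  have "char \<rho> u = 1" for u
  proof -
    have i: "integrable (\<mu> \<Otimes>\<^sub>M \<mu>) (\<lambda>p. iexp (u * (fst p - snd p)))"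
      by (intro P.integrable_iexp) auto
    have "char \<rho> u = (CLINT p|\<mu> \<Otimes>\<^sub>M \<mu>. iexp (u * (fst p - snd p)))"
      unfolding char_def \<rho>_def by (subst integral_distr) auto
    also have "\<dots> = (CLINT x|\<mu>. CLINT y|\<mu>. iexp (u * (x - y)))"
      using P.integral_fst'[OF i] by simp
    also have "\<dots> = (CLINT x|\<mu>. CLINT y|\<mu>. iexp (u * x) * cnj (iexp (u * y)))"
      by (intro Bochner_Integration.integral_cong refl)
         (simp add: exp_cnj exp_add[symmetric] algebra_simps)
    also have "\<dots> = char \<mu> u * cnj (char \<mu> u)"
      unfolding char_def by simp
    also have "\<dots> = 1" by (simp add: complex_norm_square[symmetric] one)
    finally show ?thesis .
  qed
  moreover have "char (return borel (0::real)) u = 1" for u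
    unfolding char_def by (subst integral_return) auto
  ultimately have "\<rho> = return borel 0"
    by (intro Levy_uniqueness \<rho>)
       (auto simp: real_distribution_def real_distribution_axioms_def prob_space_return)
  then have "AE z in \<rho>. z = 0" by (simp only:) (subst AE_return, auto)
  then have "AE p in \<mu> \<Otimes>\<^sub>M \<mu>. fst p - snd p = 0"
    unfolding \<rho>_def by (subst (asm) AE_distr_iff) auto
  then have "AE x in \<mu>. AE y in \<mu>. fst (x, y) - snd (x, y) = 0"
    by (rule P.AE_pair)
  then have ae: "AE x in \<mu>. AE y in \<mu>. x = y" by simp
  have "\<exists>x. AE y in \<mu>. x = y"
  proof (rule ccontr)
    assume "\<not> (\<exists>x. AE y in \<mu>. x = y)"
    with ae have "AE x in \<mu>. False" by simp
    then show False by simp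
  qed
  then show ?thesis by (auto simp: eq_commute)
qed

section \<open>Crossing probabilities of processes with independent increments\<close>

lemma sets_Collect_exceeds:
  fixes f :: "'i \<Rightarrow> 'a \<Rightarrow> real"
  assumes "finite I" and f: "\<And>i. i \<in> I \<Longrightarrow> f i \<in> borel_measurable M"
  shows "{\<omega> \<in> space M. \<exists>i\<in>I. x < f i \<omega>} \<in> sets M"
  using assms by (intro sets.sets_Collect_finite_Ex borel_measurable_less) auto

text \<open>
  The part of the notion of a Levy process that survives a change of the time scale, a change of the
  space scale and the addition of a linear drift. The crossing estimates are applied to all processes
  obtained from \<open>X\<close> and \<open>L\<close> in this way.
\<close>

locale increment_process = prob_space M for M :: "'a measure" +
  fixes F :: "real \<Rightarrow> 'a measure" and Y :: "real \<Rightarrow> 'a \<Rightarrow> real"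
  assumes space_F: "\<And>t. 0 \<le> t \<Longrightarrow> space (F t) = space M"
    and sets_F: "\<And>t. 0 \<le> t \<Longrightarrow> sets (F t) \<subseteq> events"
    and mono_F: "\<And>s t. 0 \<le> s \<Longrightarrow> s \<le> t \<Longrightarrow> sets (F s) \<subseteq> sets (F t)"
    and adapted: "\<And>t. 0 \<le> t \<Longrightarrow> Y t \<in> borel_measurable (F t)"
    and start_zero: "\<And>\<omega>. \<omega> \<in> space M \<Longrightarrow> Y 0 \<omega> = 0"
    and right_cont: "\<And>\<omega> t. \<omega> \<in> space M \<Longrightarrow> 0 \<le> t \<Longrightarrow> continuous (at_right t) (\<lambda>t. Y t \<omega>)"
    and stationary: "\<And>s t. 0 \<le> s \<Longrightarrow> s \<le> t \<Longrightarrow>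
      distr M borel (\<lambda>\<omega>. Y t \<omega> - Y s \<omega>) = distr M borel (Y (t - s))"
    and indep: "\<And>s t A B. 0 \<le> s \<Longrightarrow> s \<le> t \<Longrightarrow> A \<in> sets (F s) \<Longrightarrow> B \<in> sets borel \<Longrightarrow>
      prob (A \<inter> {\<omega> \<in> space M. Y t \<omega> - Y s \<omega> \<in> B}) = prob A * \<P>(\<omega> in M. Y t \<omega> - Y s \<omega> \<in> B)"
begin

lemma measurable_past: "0 \<le> s \<Longrightarrow> s \<le> t \<Longrightarrow> Y s \<in> borel_measurable (F t)"
  using adapted[of s] mono_F[of s t] space_F[of s] space_F[of t]
  by (auto simp: measurable_def)

lemma measurable_Y: "0 \<le> t \<Longrightarrow> Y t \<in> borel_measurable M"
  using adapted[of t] sets_F[of t] space_F[of t] by (auto simp: measurable_def)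

lemma prob_increment:
  assumes "0 \<le> s" "s \<le> t" "B \<in> sets borel"
  shows "\<P>(\<omega> in M. Y t \<omega> - Y s \<omega> \<in> B) = \<P>(\<omega> in M. Y (t - s) \<omega> \<in> B)"
proof -
  have [measurable]: "Y t \<in> borel_measurable M" "Y s \<in> borel_measurable M" "Y (t - s) \<in> borel_measurable M"
    using assms by (auto intro!: measurable_Y)
  have "measure (distr M borel (\<lambda>\<omega>. Y t \<omega> - Y s \<omega>)) B = measure (distr M borel (Y (t - s))) B"
    using stationary assms by simp
  then show ?thesis using assms(3)
    by (simp add: measure_distr vimage_def Int_def conj_commute)
qed

lemma prob_increments:
  fixes \<delta> :: real
  assumes "0 \<le> \<delta>" and A: "\<And>i. i < m \<Longrightarrow> A i \<in> sets borel"
  shows "\<P>(\<omega> in M. \<forall>i<m. Y (real (Suc i) * \<delta>) \<omega> - Y (real i * \<delta>) \<omega> \<in> A i)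
    = (\<Prod>i<m. \<P>(\<omega> in M. Y \<delta> \<omega> \<in> A i))"
proof -
  define \<xi> where "\<xi> i \<omega> = Y (real (Suc i) * \<delta>) \<omega> - Y (real i * \<delta>) \<omega>" for i \<omega>
  have "\<P>(\<omega> in M. \<forall>i<m. \<xi> i \<omega> \<in> A i) = (\<Prod>i<m. \<P>(\<omega> in M. Y \<delta> \<omega> \<in> A i))"
    using A
  proof (induction m)
    case 0
    then show ?case by (simp add: prob_space)
  next
    case (Suc m)
    have t: "0 \<le> real m * \<delta>" "real m * \<delta> \<le> real (Suc m) * \<delta>" "real (Suc m) * \<delta> - real m * \<delta> = \<delta>"
      using \<open>0 \<le> \<delta>\<close> by (auto simp: algebra_simps)
    let ?E = "{\<omega> \<in> space M. \<forall>i<m. \<xi> i \<omega> \<in> A i}"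
    have \<xi>: "\<xi> i \<in> borel_measurable (F (real m * \<delta>))" if "i < m" for i
      unfolding \<xi>_def using that \<open>0 \<le> \<delta>\<close>
      by (intro borel_measurable_diff measurable_past mult_right_mono) auto
    have "{\<omega> \<in> space (F (real m * \<delta>)). \<forall>i\<in>{..<m}. \<xi> i \<omega> \<in> A i} \<in> sets (F (real m * \<delta>))"
    proof (rule sets.sets_Collect_finite_All)
      fix i assume "i \<in> {..<m}"
      then show "{\<omega> \<in> space (F (real m * \<delta>)). \<xi> i \<omega> \<in> A i} \<in> sets (F (real m * \<delta>))"
        using measurable_sets[OF \<xi>, of i "A i"] Suc.prems[of i]
        by (simp add: vimage_def Int_def conj_commute)
    qed simp
    then have E: "?E \<in> sets (F (real m * \<delta>))"
      unfolding space_F[OF t(1)] by (simp only: Ball_def lessThan_iff)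
    have "{\<omega> \<in> space M. \<forall>i<Suc m. \<xi> i \<omega> \<in> A i} = ?E \<inter> {\<omega> \<in> space M. \<xi> m \<omega> \<in> A m}"
      unfolding less_Suc_eq by blast
    then have "\<P>(\<omega> in M. \<forall>i<Suc m. \<xi> i \<omega> \<in> A i) = prob ?E * \<P>(\<omega> in M. \<xi> m \<omega> \<in> A m)"
      using indep[OF t(1,2) E Suc.prems[of m]] unfolding \<xi>_def by simp
    also have "\<P>(\<omega> in M. \<xi> m \<omega> \<in> A m) = \<P>(\<omega> in M. Y \<delta> \<omega> \<in> A m)"
      unfolding \<xi>_def using prob_increment[OF t(1,2) Suc.prems[of m]] t(3) by simp
    finally show ?case using Suc by (simp add: mult.commute)
  qed
  then show ?thesis unfolding \<xi>_def .
qed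

lemma law_increments:
  assumes "0 \<le> \<delta>"
  shows "distr M (\<Pi>\<^sub>M i\<in>{..<m}. borel) (\<lambda>\<omega>. \<lambda>i\<in>{..<m}. Y (real (Suc i) * \<delta>) \<omega> - Y (real i * \<delta>) \<omega>)
    = (\<Pi>\<^sub>M i\<in>{..<m}. distr M borel (Y \<delta>))"
proof -
  define \<xi> where "\<xi> i \<omega> = Y (real (Suc i) * \<delta>) \<omega> - Y (real i * \<delta>) \<omega>" for i \<omega>
  have [measurable]: "Y \<delta> \<in> borel_measurable M" using assms by (auto intro!: measurable_Y)
  have h\<xi>: "\<xi> i \<in> borel_measurable M" for i
    unfolding \<xi>_def using assms by (intro borel_measurable_diff measurable_Y) auto
  have m\<xi>: "(\<lambda>\<omega>. \<lambda>i\<in>{..<m}. \<xi> i \<omega>) \<in> M \<rightarrow>\<^sub>M (\<Pi>\<^sub>M i\<in>{..<m}. borel)"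
    by (intro measurable_restrict h\<xi>)
  interpret D: prob_space "distr M borel (Y \<delta>)" by (rule prob_space_distr) auto
  interpret product_sigma_finite "\<lambda>_::nat. distr M borel (Y \<delta>)" by unfold_locales
  show ?thesis
    unfolding \<xi>_def[symmetric]
  proof (rule PiM_eqI)
    show "sets (distr M (\<Pi>\<^sub>M i\<in>{..<m}. borel) (\<lambda>\<omega>. \<lambda>i\<in>{..<m}. \<xi> i \<omega>)) = sets (\<Pi>\<^sub>M i\<in>{..<m}. distr M borel (Y \<delta>))"
      by (auto intro!: sets_PiM_cong)
    fix A assume "\<And>i. i \<in> {..<m} \<Longrightarrow> A i \<in> sets (distr M borel (Y \<delta>))"
    then have A: "\<And>i. i < m \<Longrightarrow> A i \<in> sets borel" by auto
    have "emeasure (distr M (\<Pi>\<^sub>M i\<in>{..<m}. borel) (\<lambda>\<omega>. \<lambda>i\<in>{..<m}. \<xi> i \<omega>)) (Pi\<^sub>E {..<m} A)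
      = emeasure M ((\<lambda>\<omega>. \<lambda>i\<in>{..<m}. \<xi> i \<omega>) -` Pi\<^sub>E {..<m} A \<inter> space M)"
      by (rule emeasure_distr[OF m\<xi>]) (rule sets_PiM_I_finite, simp_all add: A)
    also have "\<dots> = emeasure M {\<omega> \<in> space M. \<forall>i<m. \<xi> i \<omega> \<in> A i}"
      by (rule arg_cong[where f="emeasure M"]) (simp only: set_eq_iff PiE_iff Ball_def lessThan_iff vimage_def Int_iff mem_Collect_eq restrict_extensional restrict_apply, auto)
    also have "\<dots> = ennreal (\<Prod>i<m. \<P>(\<omega> in M. Y \<delta> \<omega> \<in> A i))"
      using prob_increments[OF assms A] unfolding \<xi>_def by (simp add: emeasure_eq_measure)
    also have "\<dots> = (\<Prod>i<m. ennreal (\<P>(\<omega> in M. Y \<delta> \<omega> \<in> A i)))"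
      by (subst prod_ennreal) auto
    also have "\<dots> = (\<Prod>i<m. emeasure (distr M borel (Y \<delta>)) (A i))"
      using A by (intro prod.cong refl) (simp add: emeasure_distr emeasure_eq_measure vimage_def Int_def conj_commute)
    finally show "emeasure (distr M (\<Pi>\<^sub>M i\<in>{..<m}. borel) (\<lambda>\<omega>. \<lambda>i\<in>{..<m}. \<xi> i \<omega>)) (Pi\<^sub>E {..<m} A)
      = (\<Prod>i\<in>{..<m}. emeasure (distr M borel (Y \<delta>)) (A i))" .
  qed simp
qed

text \<open>
  The values on a grid are partial sums of independent copies of \<open>Y \<delta>\<close>, so the probability of crossing
  a level on the grid depends on the law of \<open>Y \<delta>\<close> alone.
\<close>

lemma prob_grid_eq:
  assumes "0 \<le> \<delta>"
  shows "\<P>(\<omega> in M. \<exists>j\<le>m. x < Y (real j * \<delta>) \<omega>) =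
    \<P>(w in (\<Pi>\<^sub>M i\<in>{..<m}. distr M borel (Y \<delta>)). \<exists>j\<le>m. x < (\<Sum>i<j. w i))"
proof -
  define \<xi> where "\<xi> i \<omega> = Y (real (Suc i) * \<delta>) \<omega> - Y (real i * \<delta>) \<omega>" for i \<omega>
  have h\<xi>: "\<xi> i \<in> borel_measurable M" for i
    unfolding \<xi>_def using assms by (intro borel_measurable_diff measurable_Y) auto
  have m\<xi>: "(\<lambda>\<omega>. \<lambda>i\<in>{..<m}. \<xi> i \<omega>) \<in> M \<rightarrow>\<^sub>M (\<Pi>\<^sub>M i\<in>{..<m}. borel)"
    by (intro measurable_restrict h\<xi>)
  have ms: "(\<lambda>w. \<Sum>i<j. w i) \<in> borel_measurable (\<Pi>\<^sub>M i\<in>{..<m}. borel :: real measure)" if "j \<in> {..m}" for j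
    using that by (intro borel_measurable_sum measurable_component_singleton) auto
  have "{w \<in> space (\<Pi>\<^sub>M i\<in>{..<m}. borel :: real measure). \<exists>j\<in>{..m}. x < (\<Sum>i<j. w i)} \<in> sets (\<Pi>\<^sub>M i\<in>{..<m}. borel)"
    by (intro sets_Collect_exceeds ms) auto
  then have S: "{w \<in> space (\<Pi>\<^sub>M i\<in>{..<m}. borel :: real measure). \<exists>j\<le>m. x < (\<Sum>i<j. w i)} \<in> sets (\<Pi>\<^sub>M i\<in>{..<m}. borel)"
    by (simp only: Bex_def atMost_iff)
  have tele: "(\<Sum>i<j. \<xi> i \<omega>) = Y (real j * \<delta>) \<omega>" if "\<omega> \<in> space M" for j \<omega>
    using sum_lessThan_telescope[of "\<lambda>i. Y (real i * \<delta>) \<omega>" j] start_zero[OF that] by (simp add: \<xi>_def)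
  have "\<P>(w in (\<Pi>\<^sub>M i\<in>{..<m}. distr M borel (Y \<delta>)). \<exists>j\<le>m. x < (\<Sum>i<j. w i)) =
    prob ((\<lambda>\<omega>. \<lambda>i\<in>{..<m}. \<xi> i \<omega>) -` {w \<in> space (\<Pi>\<^sub>M i\<in>{..<m}. borel :: real measure). \<exists>j\<le>m. x < (\<Sum>i<j. w i)} \<inter> space M)"
    using measure_distr[OF m\<xi> S] unfolding \<xi>_def law_increments[OF assms] by (simp add: space_PiM)
  also have "(\<lambda>\<omega>. \<lambda>i\<in>{..<m}. \<xi> i \<omega>) -` {w \<in> space (\<Pi>\<^sub>M i\<in>{..<m}. borel :: real measure). \<exists>j\<le>m. x < (\<Sum>i<j. w i)} \<inter> space M
      = {\<omega> \<in> space M. \<exists>j\<le>m. x < Y (real j * \<delta>) \<omega>}"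
  proof -
    have "(\<Sum>i<j. (\<lambda>i\<in>{..<m}. \<xi> i \<omega>) i) = Y (real j * \<delta>) \<omega>" if "j \<le> m" "\<omega> \<in> space M" for j \<omega>
      using that by (subst tele[symmetric]) (auto intro!: sum.cong)
    then show ?thesis by (fastforce simp: space_PiM)
  qed
  finally show ?thesis by simp
qed

text \<open>
  The coarse grid \<open>j * \<delta>\<close> is refined by the factor \<open>r\<close>. At the first fine grid point where the
  process exceeds \<open>x + e\<close>, it decides independently of the past, with probability at least \<open>1 - \<eta>\<close>,
  not to lose more than \<open>e\<close> until the next coarse grid point.
\<close>

lemma discrete_Ottaviani:
  fixes r m :: nat
  assumes "0 < \<delta>" "0 < r" and small: "\<And>s. 0 \<le> s \<Longrightarrow> s \<le> \<delta> \<Longrightarrow> \<P>(\<omega> in M. Y s \<omega> < - e) \<le> \<eta>"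
  shows "\<P>(\<omega> in M. \<exists>i\<le>m * r. x + e < Y (real i * \<delta> / real r) \<omega>) * (1 - \<eta>) \<le> \<P>(\<omega> in M. \<exists>j\<le>m. x < Y (real j * \<delta>) \<omega>)"
proof -
  define t where "t i = real i * \<delta> / real r" for i
  \<comment> \<open>\<open>t i\<close> is the \<open>i\<close>-th fine grid point and \<open>c i\<close> the first coarse one that is not earlier\<close>
  define c where "c i = real ((i + r - 1) div r) * \<delta>" for i
  have t0: "0 \<le> t i" and t_mono: "i \<le> j \<Longrightarrow> t i \<le> t j" for i j
    using assms unfolding t_def by (auto intro!: divide_right_mono mult_right_mono)
  have c: "t i \<le> c i" "c i - t i \<le> \<delta>" for i
  proof -
    have "i \<le> ((i + r - 1) div r) * r" "((i + r - 1) div r) * r \<le> i + r"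
      using \<open>0 < r\<close> div_mult_mod_eq[of "i + r - 1" r] mod_less_divisor[of r "i + r - 1"] by linarith+
    then have "real i \<le> real ((i + r - 1) div r) * real r" "real ((i + r - 1) div r) * real r \<le> real i + real r"
      by (metis of_nat_le_iff of_nat_mult, metis of_nat_add of_nat_le_iff of_nat_mult)
    then have "real i / real r \<le> real ((i + r - 1) div r)" "real ((i + r - 1) div r) \<le> real i / real r + 1"
      using \<open>0 < r\<close> by (auto simp: field_simps)
    then have "(real i / real r) * \<delta> \<le> c i" "c i \<le> (real i / real r + 1) * \<delta>"
      unfolding c_def using \<open>0 < \<delta>\<close> by (metis less_imp_le mult_right_mono)+
    then show "t i \<le> c i" "c i - t i \<le> \<delta>" unfolding t_def by (auto simp: algebra_simps)
  qed
  have c0: "0 \<le> c i" for i using c(1)[of i] t0[of i] by linarith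
  \<comment> \<open>\<open>A i\<close>: the level is exceeded first at \<open>t i\<close>; \<open>B i\<close>: the loss until \<open>c i\<close> is at most \<open>e\<close>\<close>
  define A where "A i = {\<omega> \<in> space M. x + e < Y (t i) \<omega> \<and> (\<forall>i'\<in>{..<i}. Y (t i') \<omega> \<le> x + e)}" for i
  define B where "B i = {\<omega> \<in> space M. Y (c i) \<omega> - Y (t i) \<omega> \<in> {-e..}}" for i
  have A_F: "A i \<in> sets (F (t i))" for i
  proof -
    have Yt: "Y (t j) \<in> borel_measurable (F (t i))" if "j \<le> i" for j
      using that t0 t_mono by (intro measurable_past) auto
    have "{\<omega> \<in> space (F (t i)). x + e < Y (t i) \<omega> \<and> (\<forall>i'\<in>{..<i}. Y (t i') \<omega> \<le> x + e)} \<in> sets (F (t i))"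
      by (intro sets.sets_Collect_conj sets.sets_Collect_finite_All borel_measurable_less borel_measurable_le Yt) auto
    then show ?thesis unfolding A_def using space_F t0 by simp
  qed
  then have A_M: "A i \<in> events" for i using sets_F t0 by blast
  have [measurable]: "Y (c i) \<in> borel_measurable M" "Y (t i) \<in> borel_measurable M" for i
    using t0 c0 by (auto intro!: measurable_Y)
  have B_M: "B i \<in> events" for i unfolding B_def by measurable
  have PB: "1 - \<eta> \<le> prob (B i)" for i
  proof -
    have [measurable]: "Y (c i - t i) \<in> borel_measurable M" using c(1)[of i] by (auto intro!: measurable_Y)
    have "prob (B i) = \<P>(\<omega> in M. Y (c i - t i) \<omega> \<in> {-e..})"
      unfolding B_def using t0 c by (intro prob_increment) auto
    also have "\<dots> = 1 - \<P>(\<omega> in M. \<not> Y (c i - t i) \<omega> \<in> {-e..})"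
      by (subst prob_neg) auto
    also have "\<P>(\<omega> in M. \<not> Y (c i - t i) \<omega> \<in> {-e..}) = \<P>(\<omega> in M. Y (c i - t i) \<omega> < - e)"
      by (simp add: not_le)
    finally show ?thesis using small[of "c i - t i"] c[of i] by simp
  qed
  have dA: "disjoint_family_on A {..m * r}"
    unfolding disjoint_family_on_def
  proof (intro ballI impI)
    have later: "A i \<inter> A j = {}" if "i < j" for i j
      using that by (force simp: A_def)
    fix i j :: nat assume "i \<noteq> j"
    then show "A i \<inter> A j = {}"
      using later[of i j] later[of j i] by (cases i j rule: linorder_cases) auto
  qed
  then have dAB: "disjoint_family_on (\<lambda>i. A i \<inter> B i) {..m * r}"
    unfolding disjoint_family_on_def by blast
  have "{\<omega> \<in> space M. \<exists>i\<le>m * r. x + e < Y (t i) \<omega>} = (\<Union>i\<in>{..m * r}. A i)"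
  proof (intro set_eqI iffI)
    fix \<omega> assume "\<omega> \<in> {\<omega> \<in> space M. \<exists>i\<le>m * r. x + e < Y (t i) \<omega>}"
    then obtain i where i: "\<omega> \<in> space M" "i \<le> m * r" "x + e < Y (t i) \<omega>" by auto
    define k where "k = (LEAST i. x + e < Y (t i) \<omega>)"
    have "x + e < Y (t k) \<omega>" "k \<le> i" "\<forall>i'<k. \<not> x + e < Y (t i') \<omega>"
      using i(3) not_less_Least unfolding k_def by (auto intro: LeastI Least_le)
    then show "\<omega> \<in> (\<Union>i\<in>{..m * r}. A i)"
      using i by (auto simp: A_def not_less intro!: bexI[of _ k])
  qed (auto simp: A_def)
  then have "\<P>(\<omega> in M. \<exists>i\<le>m * r. x + e < Y (t i) \<omega>) = (\<Sum>i\<le>m * r. prob (A i))"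
    using finite_measure_finite_Union[of "{..m * r}" A] dA A_M by auto
  then have "\<P>(\<omega> in M. \<exists>i\<le>m * r. x + e < Y (t i) \<omega>) * (1 - \<eta>) = (\<Sum>i\<le>m * r. prob (A i) * (1 - \<eta>))"
    by (simp add: sum_distrib_right)
  also have "\<dots> \<le> (\<Sum>i\<le>m * r. prob (A i) * prob (B i))"
    by (intro sum_mono mult_left_mono PB) auto
  also have "\<dots> = (\<Sum>i\<le>m * r. prob (A i \<inter> B i))"
    unfolding B_def using t0 c A_F by (subst indep) auto
  also have "\<dots> = prob (\<Union>i\<in>{..m * r}. A i \<inter> B i)"
    using dAB A_M B_M by (intro finite_measure_finite_Union[symmetric]) auto
  also have "\<dots> \<le> \<P>(\<omega> in M. \<exists>j\<in>{..m}. x < Y (real j * \<delta>) \<omega>)"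
  proof (rule finite_measure_mono)
    show "{\<omega> \<in> space M. \<exists>j\<in>{..m}. x < Y (real j * \<delta>) \<omega>} \<in> events"
      using \<open>0 < \<delta>\<close> by (intro sets_Collect_exceeds measurable_Y) auto
    show "(\<Union>i\<in>{..m * r}. A i \<inter> B i) \<subseteq> {\<omega> \<in> space M. \<exists>j\<in>{..m}. x < Y (real j * \<delta>) \<omega>}"
    proof
      fix \<omega> assume "\<omega> \<in> (\<Union>i\<in>{..m * r}. A i \<inter> B i)"
      then obtain i where i: "i \<le> m * r" "\<omega> \<in> A i" "\<omega> \<in> B i" by auto
      have "(i + r - 1) div r \<le> (m * r + (r - 1)) div r"
        using i \<open>0 < r\<close> by (intro div_le_mono) auto
      also have "\<dots> = m" using \<open>0 < r\<close> by (intro div_nat_eqI) (auto simp: algebra_simps)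
      finally show "\<omega> \<in> {\<omega> \<in> space M. \<exists>j\<in>{..m}. x < Y (real j * \<delta>) \<omega>}"
        using i unfolding A_def B_def c_def by force
    qed
  qed
  finally show ?thesis unfolding t_def by (simp only: Bex_def atMost_iff)
qed

lemma exceeds_at_dyadic:
  assumes "\<omega> \<in> space M" "0 \<le> t" "t < b" "y < Y t \<omega>" "0 < \<delta>"
  obtains s i :: nat where "t < real i * \<delta> / 2 ^ s" "real i * \<delta> / 2 ^ s < b" "y < Y (real i * \<delta> / 2 ^ s) \<omega>"
proof -
  have "((\<lambda>t. Y t \<omega>) \<longlongrightarrow> Y t \<omega>) (at_right t)"
    using right_cont[OF assms(1,2)] by (simp add: continuous_within)
  then have "\<forall>\<^sub>F t' in at_right t. y < Y t' \<omega>" using assms(4) by (rule order_tendstoD)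
  then obtain b' where b': "t < b'" "\<And>t'. t < t' \<Longrightarrow> t' < b' \<Longrightarrow> y < Y t' \<omega>"
    unfolding eventually_at_right_field by blast
  define h where "h = min b b' - t"
  have "0 < h" using assms b' by (simp add: h_def)
  obtain s :: nat where s: "\<delta> / h < 2 ^ s" using real_arch_pow[of 2 "\<delta> / h"] by auto
  then have s': "\<delta> / 2 ^ s < h" using \<open>0 < h\<close> by (simp add: field_simps)
  define i where "i = nat \<lfloor>t * 2 ^ s / \<delta>\<rfloor> + 1"
  have "0 \<le> t * 2 ^ s / \<delta>" using assms by simp
  then have "real i = of_int \<lfloor>t * 2 ^ s / \<delta>\<rfloor> + 1" unfolding i_def by simp
  then have "t * 2 ^ s / \<delta> < real i" "real i \<le> t * 2 ^ s / \<delta> + 1" by linarith+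
  then have "t < real i * \<delta> / 2 ^ s" "real i * \<delta> / 2 ^ s \<le> t + \<delta> / 2 ^ s"
    using \<open>0 < \<delta>\<close> by (auto simp: field_simps)
  then show ?thesis using that[of i s] s' b'(2)[of "real i * \<delta> / 2 ^ s"] by (auto simp: h_def)
qed

text \<open>
  Since the bound for the fine grids does not depend on the mesh, right continuity of the paths
  extends it to all times of the interval.
\<close>

lemma Ottaviani:
  assumes "0 < \<delta>" and small: "\<And>s. 0 \<le> s \<Longrightarrow> s \<le> \<delta> \<Longrightarrow> \<P>(\<omega> in M. Y s \<omega> < - e) \<le> \<eta>"
  shows "{\<omega> \<in> space M. \<exists>t\<in>{0..real m * \<delta>}. x + e < Y t \<omega>} \<in> events" (is "?E \<in> _")
    and "\<P>(\<omega> in M. \<exists>t\<in>{0..real m * \<delta>}. x + e < Y t \<omega>) * (1 - \<eta>)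
      \<le> \<P>(\<omega> in M. \<exists>j\<le>m. x < Y (real j * \<delta>) \<omega>)"
proof -
  define D where "D s = {\<omega> \<in> space M. \<exists>i\<in>{..m * 2 ^ s}. x + e < Y (real i * \<delta> / 2 ^ s) \<omega>}" for s :: nat
  have D: "D s \<in> events" for s
    unfolding D_def using \<open>0 < \<delta>\<close> by (intro sets_Collect_exceeds measurable_Y) auto
  have UD: "?E = (\<Union>s. D s)"
  proof (intro set_eqI iffI)
    fix \<omega> assume "\<omega> \<in> ?E"
    then obtain t where t: "\<omega> \<in> space M" "0 \<le> t" "t \<le> real m * \<delta>" "x + e < Y t \<omega>" by auto
    show "\<omega> \<in> (\<Union>s. D s)"
    proof (cases "t = real m * \<delta>")
      case True
      then have "\<omega> \<in> D 0" using t by (auto simp: D_def intro!: bexI[of _ m])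
      then show ?thesis by auto
    next
      case False
      then have "t < real m * \<delta>" using t(3) by simp
      then obtain s i :: nat where "t < real i * \<delta> / 2 ^ s"
        and si: "real i * \<delta> / 2 ^ s < real m * \<delta>" "x + e < Y (real i * \<delta> / 2 ^ s) \<omega>"
        by (rule exceeds_at_dyadic[OF t(1,2) _ t(4) \<open>0 < \<delta>\<close>])
      then have "real i < real m * 2 ^ s" using \<open>0 < \<delta>\<close> by (simp add: field_simps)
      then have "real i < real (m * 2 ^ s)" by simp
      then have "i \<le> m * 2 ^ s" by linarith
      then have "\<omega> \<in> D s" using si t by (auto simp: D_def)
      then show ?thesis by auto
    qed
  next
    fix \<omega> assume "\<omega> \<in> (\<Union>s. D s)"
    then obtain s i where si: "\<omega> \<in> space M" "i \<le> m * 2 ^ s" "x + e < Y (real i * \<delta> / 2 ^ s) \<omega>"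
      by (auto simp: D_def)
    have "real i \<le> real (m * 2 ^ s)" using si(2) by linarith
    then have "real i * \<delta> / 2 ^ s \<in> {0..real m * \<delta>}" using \<open>0 < \<delta>\<close> by (simp add: field_simps)
    then show "\<omega> \<in> ?E" using si by blast
  qed
  show E: "?E \<in> events" unfolding UD using D by auto
  have "incseq D"
  proof (rule incseq_SucI, rule subsetI)
    fix s \<omega> assume "\<omega> \<in> D s"
    then obtain i where i: "\<omega> \<in> space M" "i \<le> m * 2 ^ s" "x + e < Y (real i * \<delta> / 2 ^ s) \<omega>"
      by (auto simp: D_def)
    moreover have "real (2 * i) * \<delta> / 2 ^ Suc s = real i * \<delta> / 2 ^ s" by simp
    moreover have "2 * i \<le> m * 2 ^ Suc s" using i(2) by simp
    ultimately show "\<omega> \<in> D (Suc s)" unfolding D_def by (metis (mono_tags, lifting) atMost_iff mem_Collect_eq)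
  qed
  then have "(\<lambda>s. prob (D s)) \<longlonglongrightarrow> prob ?E"
    unfolding UD using D by (intro finite_Lim_measure_incseq) auto
  then have "(\<lambda>s. prob (D s) * (1 - \<eta>)) \<longlonglongrightarrow> prob ?E * (1 - \<eta>)" by (intro tendsto_intros)
  then show "prob ?E * (1 - \<eta>) \<le> \<P>(\<omega> in M. \<exists>j\<le>m. x < Y (real j * \<delta>) \<omega>)"
  proof (rule LIMSEQ_le_const2, intro exI[of _ 0] allI impI)
    fix s :: nat
    have r: "(0::nat) < 2 ^ s" by simp
    show "prob (D s) * (1 - \<eta>) \<le> \<P>(\<omega> in M. \<exists>j\<le>m. x < Y (real j * \<delta>) \<omega>)"
      using discrete_Ottaviani[OF \<open>0 < \<delta>\<close> r small, of m x]
      unfolding D_def by (simp add: Bex_def)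
  qed
qed

abbreviation crossing :: "real \<Rightarrow> 'a set" where
  "crossing x \<equiv> {\<omega> \<in> space M. \<exists>t\<ge>0. x < Y t \<omega>}"

text \<open>
  The \<open>s\<close>-th grid has mesh \<open>1 / 2 ^ s\<close> and horizon \<open>2 ^ s\<close>. These grids are nested and exhaust the
  dyadic times, which suffice for right continuous paths.
\<close>

lemma crossing_grid:
  defines "D \<equiv> \<lambda>x s. {\<omega> \<in> space M. \<exists>i\<le>4 ^ s. x < Y (real i * (1 / 2 ^ s)) \<omega>}"
  shows "crossing x \<in> events" and "(\<lambda>s. prob (D x s)) \<longlonglongrightarrow> prob (crossing x)"
proof -
  have "{\<omega> \<in> space M. \<exists>i\<in>{..4 ^ s}. x < Y (real i * (1 / 2 ^ s)) \<omega>} \<in> events" for s :: nat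
    by (intro sets_Collect_exceeds measurable_Y) auto
  then have D: "D x s \<in> events" for s unfolding D_def by (simp only: Bex_def atMost_iff)
  have UD: "crossing x = (\<Union>s. D x s)"
  proof (intro set_eqI iffI)
    fix \<omega> assume "\<omega> \<in> crossing x"
    then obtain t where t: "\<omega> \<in> space M" "0 \<le> t" "x < Y t \<omega>" by auto
    obtain s i :: nat where "t < real i * 1 / 2 ^ s" "real i * 1 / 2 ^ s < t + 1"
      and si: "x < Y (real i * 1 / 2 ^ s) \<omega>"
      by (rule exceeds_at_dyadic[OF t(1,2) less_add_one t(3) zero_less_one])
    \<comment> \<open>refine the mesh until the horizon \<open>2 ^ (s + i)\<close> passes the crossing time\<close>
    have "i * 2 ^ i \<le> 4 ^ (s + i)"
    proof -
      have "i * 2 ^ i \<le> 2 ^ i * 2 ^ i" by (simp add: less_imp_le)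
      also have "\<dots> = 4 ^ i" by (simp add: power_mult_distrib[symmetric])
      also have "\<dots> \<le> 4 ^ (s + i)" by (intro power_increasing) auto
      finally show ?thesis .
    qed
    moreover have "real (i * 2 ^ i) * (1 / 2 ^ (s + i)) = real i * 1 / 2 ^ s" by (simp add: power_add)
    ultimately have "\<omega> \<in> D x (s + i)" unfolding D_def using si t(1)
      by (metis (mono_tags, lifting) mem_Collect_eq)
    then show "\<omega> \<in> (\<Union>s. D x s)" by auto
  next
    fix \<omega> assume "\<omega> \<in> (\<Union>s. D x s)"
    then obtain s i where si: "\<omega> \<in> space M" "x < Y (real i * (1 / 2 ^ s)) \<omega>"
      by (auto simp: D_def)
    moreover have "0 \<le> real i * (1 / 2 ^ s)" by simp
    ultimately show "\<omega> \<in> crossing x" by blast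
  qed
  show "crossing x \<in> events" unfolding UD using D by auto
  have "incseq (D x)"
  proof (rule incseq_SucI, rule subsetI)
    fix s \<omega> assume "\<omega> \<in> D x s"
    then obtain i where i: "\<omega> \<in> space M" "i \<le> 4 ^ s" "x < Y (real i * (1 / 2 ^ s)) \<omega>"
      by (auto simp: D_def)
    moreover have "real (2 * i) * (1 / 2 ^ Suc s) = real i * (1 / 2 ^ s)" by simp
    moreover have "2 * i \<le> 4 ^ Suc s" using i(2) by simp
    ultimately show "\<omega> \<in> D x (Suc s)" unfolding D_def by (metis (mono_tags, lifting) mem_Collect_eq)
  qed
  then show "(\<lambda>s. prob (D x s)) \<longlonglongrightarrow> prob (crossing x)"
    unfolding UD using D by (intro finite_Lim_measure_incseq) auto
qed

lemma prob_grid_le_crossing: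
  assumes "0 \<le> \<delta>"
  shows "\<P>(\<omega> in M. \<exists>j\<le>m. x < Y (real j * \<delta>) \<omega>) \<le> prob (crossing x)"
proof (intro finite_measure_mono crossing_grid(1) subsetI)
  fix \<omega> assume "\<omega> \<in> {\<omega> \<in> space M. \<exists>j\<le>m. x < Y (real j * \<delta>) \<omega>}"
  then obtain j :: nat where "\<omega> \<in> space M" "x < Y (real j * \<delta>) \<omega>" by auto
  moreover have "0 \<le> real j * \<delta>" using assms by simp
  ultimately show "\<omega> \<in> crossing x" by blast
qed

lemma prob_grid_tendsto_0:
  assumes "0 \<le> \<delta>"
  shows "(\<lambda>k. \<P>(\<omega> in M. \<exists>j\<le>m. real k < Y (real j * \<delta>) \<omega>)) \<longlonglongrightarrow> 0"
proof -
  define D where "D k = {\<omega> \<in> space M. \<exists>j\<in>{..m}. real k < Y (real j * \<delta>) \<omega>}" for k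
  have "D k \<in> events" for k
    unfolding D_def using assms by (intro sets_Collect_exceeds measurable_Y) auto
  moreover have "decseq D"
  proof (rule decseq_SucI, rule subsetI)
    fix k \<omega> assume "\<omega> \<in> D (Suc k)"
    then obtain j where "\<omega> \<in> space M" "j \<le> m" "real (Suc k) < Y (real j * \<delta>) \<omega>"
      by (auto simp: D_def)
    moreover from this have "real k < Y (real j * \<delta>) \<omega>" by simp
    ultimately show "\<omega> \<in> D k" unfolding D_def by blast
  qed
  ultimately have "(\<lambda>k. prob (D k)) \<longlonglongrightarrow> prob (\<Inter>k. D k)"
    by (intro finite_Lim_measure_decseq) auto
  moreover have "(\<Inter>k. D k) = {}"
  proof (rule ccontr)
    assume "(\<Inter>k. D k) \<noteq> {}"
    then obtain \<omega> where \<omega>: "\<And>k. \<omega> \<in> D k" by auto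
    obtain k where "(\<Sum>j\<le>m. \<bar>Y (real j * \<delta>) \<omega>\<bar>) < real k" using reals_Archimedean2 by blast
    moreover obtain j where j: "j \<le> m" "real k < Y (real j * \<delta>) \<omega>" using \<omega>[of k] by (auto simp: D_def)
    moreover have "\<bar>Y (real j * \<delta>) \<omega>\<bar> \<le> (\<Sum>j\<le>m. \<bar>Y (real j * \<delta>) \<omega>\<bar>)"
      using j(1) by (intro member_le_sum) auto
    ultimately show False by linarith
  qed
  ultimately show ?thesis by (simp add: D_def Bex_def)
qed

end

lemma (in increment_process) crossing_antimono:
  "x \<le> y \<Longrightarrow> prob (crossing y) \<le> prob (crossing x)"
  using crossing_grid(1)[of x] by (intro finite_measure_mono) (auto intro: le_less_trans)

text \<open>
  Once the crossing probabilities of high levels vanish, the supremum is finite almost surely, and its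
  distribution function is read off the crossing probabilities.
\<close>

lemma (in increment_process) sup_over_half_line:
  assumes tight: "\<And>e. 0 < e \<Longrightarrow> \<exists>x. prob (crossing x) \<le> e"
  shows "AE \<omega> in M. bdd_above ((\<lambda>t. Y t \<omega>) ` {0..})"
    and "(\<lambda>\<omega>. SUP t\<in>{0..}. Y t \<omega>) \<in> borel_measurable M"
    and "\<P>(\<omega> in M. (SUP t\<in>{0..}. Y t \<omega>) \<le> x) = 1 - prob (crossing x)"
proof -
  let ?S = "\<lambda>\<omega>. SUP t\<in>{0..}. Y t \<omega>"
  define U where "U = (\<Inter>k. crossing (real k))"
  have U: "U \<in> events" unfolding U_def using crossing_grid(1) by blast
  have bdd: "bdd_above ((\<lambda>t. Y t \<omega>) ` {0..}) \<longleftrightarrow> \<omega> \<notin> U" if "\<omega> \<in> space M" for \<omega>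
  proof
    assume "bdd_above ((\<lambda>t. Y t \<omega>) ` {0..})"
    then obtain B where "\<And>t. 0 \<le> t \<Longrightarrow> Y t \<omega> \<le> B" unfolding bdd_above_def by auto
    moreover obtain k where "B < real k" using reals_Archimedean2 by blast
    ultimately have "\<omega> \<notin> crossing (real k)" by (auto simp: not_less intro: order_trans less_imp_le)
    then show "\<omega> \<notin> U" by (auto simp: U_def)
  next
    assume "\<omega> \<notin> U"
    then obtain k where "\<omega> \<notin> crossing (real k)" by (auto simp: U_def)
    then have "Y t \<omega> \<le> real k" if "0 \<le> t" for t using \<open>\<omega> \<in> space M\<close> that by (auto simp: not_less)
    then show "bdd_above ((\<lambda>t. Y t \<omega>) ` {0..})" by (auto intro!: bdd_aboveI2)
  qed
  have "prob U \<le> e" if e: "0 < e" for e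
  proof -
    obtain x where x: "prob (crossing x) \<le> e" using tight[OF e] by blast
    obtain k where "x < real k" using reals_Archimedean2 by blast
    have "prob U \<le> prob (crossing (real k))"
      using crossing_grid(1) by (intro finite_measure_mono) (auto simp: U_def)
    also have "\<dots> \<le> prob (crossing x)" using \<open>x < real k\<close> by (intro crossing_antimono) simp
    finally show ?thesis using x by simp
  qed
  then have U0: "prob U = 0" by (metis dense not_le measure_nonneg less_le)
  then have "emeasure M U = 0" by (simp add: emeasure_eq_measure)
  then have AEU: "AE \<omega> in M. \<omega> \<notin> U" using U by (intro AE_not_in) (simp add: null_sets_def)
  then show "AE \<omega> in M. bdd_above ((\<lambda>t. Y t \<omega>) ` {0..})"
    using AE_space by eventually_elim (simp add: bdd)
  have gt: "{\<omega> \<in> space M. x < ?S \<omega>} = (crossing x - U) \<union> (if x < Sup UNIV then U else {})" for x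
  proof -
    have S1: "x < ?S \<omega> \<longleftrightarrow> (\<exists>t\<ge>0. x < Y t \<omega>)" if "\<omega> \<in> space M" "\<omega> \<notin> U" for \<omega>
      using bdd[OF that(1)] that(2) by (subst less_cSUP_iff) auto
    \<comment> \<open>all sets of reals without an upper bound have the same default supremum, which makes \<open>?S\<close> constant on \<open>U\<close>\<close>
    have S2: "?S \<omega> = Sup UNIV" if "\<omega> \<in> U" for \<omega>
    proof -
      have "\<omega> \<in> space M" using that U sets.sets_into_space by blast
      then have "\<not> bdd_above ((\<lambda>t. Y t \<omega>) ` {0..})" using bdd that by blast
      then have 1: "(\<lambda>z. \<forall>y\<in>(\<lambda>t. Y t \<omega>) ` {0..}. y \<le> z) = (\<lambda>z. False)"
        unfolding bdd_above_def by (intro ext) blast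
      have 2: "(\<lambda>z::real. \<forall>y\<in>UNIV. y \<le> z) = (\<lambda>z. False)"
        by (metis UNIV_I gt_ex linorder_not_less)
      show ?thesis unfolding Sup_real_def 1 2 ..
    qed
    have "U \<subseteq> space M" using U by (rule sets.sets_into_space)
    show ?thesis
    proof (rule set_eqI)
      fix \<omega>
      show "\<omega> \<in> {\<omega> \<in> space M. x < ?S \<omega>} \<longleftrightarrow> \<omega> \<in> (crossing x - U) \<union> (if x < Sup UNIV then U else {})"
      proof (cases "\<omega> \<in> U")
        case True
        then show ?thesis using S2[OF True] \<open>U \<subseteq> space M\<close> by auto
      next
        case False
        then show ?thesis using S1[of \<omega>] by auto
      qed
    qed
  qed
  have "{\<omega> \<in> space M. x < ?S \<omega>} \<in> events" for x
    unfolding gt using U crossing_grid(1) by auto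
  then show S: "?S \<in> borel_measurable M" by (simp add: borel_measurable_iff_greater)
  have "\<P>(\<omega> in M. ?S \<omega> \<le> x) = \<P>(\<omega> in M. \<not> x < ?S \<omega>)" by (simp add: not_less)
  also have "\<dots> = 1 - \<P>(\<omega> in M. x < ?S \<omega>)"
    using S by (intro prob_neg) auto
  also have "\<P>(\<omega> in M. x < ?S \<omega>) = prob (crossing x)"
  proof (rule finite_measure_eq_AE)
    show "AE \<omega> in M. \<omega> \<in> {\<omega> \<in> space M. x < ?S \<omega>} \<longleftrightarrow> \<omega> \<in> crossing x"
      using AEU AE_space by eventually_elim (use gt[of x] in \<open>auto split: if_splits\<close>)
    show "{\<omega> \<in> space M. x < ?S \<omega>} \<in> events" by fact
  qed (rule crossing_grid(1))
  finally show "\<P>(\<omega> in M. ?S \<omega> \<le> x) = 1 - prob (crossing x)" .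
qed

text \<open>
  Skorohod's copies of a single summand, taken independently for all summands, make all partial sums
  converge almost surely. The conclusion compares distribution functions in the manner of the Levy
  metric, with shifts of the level and of the probability; this is the form that later estimates can
  be chained with.
\<close>

lemma partial_sums_weak_conv:
  fixes \<mu> :: "nat \<Rightarrow> real measure" and m :: nat
  assumes \<mu>: "\<And>k. real_distribution (\<mu> k)" and \<mu>': "real_distribution \<mu>'" and w: "weak_conv_m \<mu> \<mu>'" and "0 < e"
  defines "G \<equiv> \<lambda>\<nu> x. \<P>(w in (\<Pi>\<^sub>M i\<in>{..<m}. \<nu>). \<exists>j\<le>m. x < (\<Sum>i<j. w i))"
  shows "\<forall>\<^sub>F k in sequentially. \<forall>x. G (\<mu> k) x \<le> G \<mu>' (x - e) + e \<and> G \<mu>' x \<le> G (\<mu> k) (x - e) + e"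
proof -
  obtain \<Omega> :: "real measure" and V :: "nat \<Rightarrow> real \<Rightarrow> real" and V' :: "real \<Rightarrow> real"
    where \<Omega>: "prob_space \<Omega>" and V: "\<And>n. V n \<in> measurable \<Omega> borel"
      "\<And>n. distr \<Omega> borel (V n) = \<mu> n" and V': "V' \<in> measurable \<Omega> lborel" and V'd: "distr \<Omega> borel V' = \<mu>'"
      and conv: "\<And>x. x \<in> space \<Omega> \<Longrightarrow> (\<lambda>n. V n x) \<longlonglongrightarrow> V' x"
    using Skorohod[OF \<mu> \<mu>' w] by blast
  have V': "V' \<in> borel_measurable \<Omega>" using V' by simp
  let ?P = "\<Pi>\<^sub>M i\<in>{..<m}. \<Omega>"
  interpret P: prob_space ?P using \<Omega> by (intro prob_space_PiM)
  have comp: "(\<lambda>w. U (w i)) \<in> borel_measurable ?P" if "U \<in> borel_measurable \<Omega>" "i < m" for U :: "real \<Rightarrow> real" and i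
    using that by (intro measurable_compose[OF measurable_component_singleton]) auto
  have G: "{w \<in> space ?P. \<exists>j\<le>m. x < (\<Sum>i<j. U (w i))} \<in> sets ?P \<and>
      G (distr \<Omega> borel U) x = \<P>(w in ?P. \<exists>j\<le>m. x < (\<Sum>i<j. U (w i)))"
    if U[measurable]: "U \<in> borel_measurable \<Omega>" for U x
  proof -
    let ?S = "{w \<in> space (\<Pi>\<^sub>M i\<in>{..<m}. borel :: real measure). \<exists>j\<le>m. x < (\<Sum>i<j. w i)}"
    have ms: "(\<lambda>w. \<Sum>i<j. w i) \<in> borel_measurable (\<Pi>\<^sub>M i\<in>{..<m}. borel :: real measure)" if "j \<in> {..m}" for j
      using that by (intro borel_measurable_sum measurable_component_singleton) auto
    have "{w \<in> space (\<Pi>\<^sub>M i\<in>{..<m}. borel :: real measure). \<exists>j\<in>{..m}. x < (\<Sum>i<j. w i)} \<in> sets (\<Pi>\<^sub>M i\<in>{..<m}. borel)"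
      by (intro sets_Collect_exceeds ms) auto
    then have S: "?S \<in> sets (\<Pi>\<^sub>M i\<in>{..<m}. borel)"
      by (simp only: Bex_def atMost_iff)
    have law: "distr ?P (\<Pi>\<^sub>M i\<in>{..<m}. borel) (compose {..<m} U) = (\<Pi>\<^sub>M i\<in>{..<m}. distr \<Omega> borel U)"
    proof -
      have "distr ?P (\<Pi>\<^sub>M i\<in>{..<m}. distr \<Omega> borel U) (compose {..<m} U) = (\<Pi>\<^sub>M i\<in>{..<m}. distr \<Omega> (distr \<Omega> borel U) U)"
        using \<Omega> by (intro distr_PiM_finite_prob_space') (auto intro: prob_space.prob_space_distr)
      moreover have "distr \<Omega> (distr \<Omega> borel U) U = distr \<Omega> borel U" by (rule distr_cong) auto
      moreover have "distr ?P (\<Pi>\<^sub>M i\<in>{..<m}. distr \<Omega> borel U) (compose {..<m} U) = distr ?P (\<Pi>\<^sub>M i\<in>{..<m}. borel) (compose {..<m} U)"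
        by (rule distr_cong) (auto intro!: sets_PiM_cong)
      ultimately show ?thesis by simp
    qed
    have mc: "compose {..<m} U \<in> ?P \<rightarrow>\<^sub>M (\<Pi>\<^sub>M i\<in>{..<m}. borel)"
      unfolding compose_def by (intro measurable_restrict comp) auto
    have eq: "compose {..<m} U -` ?S \<inter> space ?P = {w \<in> space ?P. \<exists>j\<le>m. x < (\<Sum>i<j. U (w i))}"
    proof -
      have "(\<Sum>i<j. compose {..<m} U w i) = (\<Sum>i<j. U (w i))" if "j \<le> m" for j w
        using that by (intro sum.cong) (auto simp: compose_def)
      then show ?thesis by (fastforce simp: space_PiM compose_def)
    qed
    have "G (distr \<Omega> borel U) x = measure (distr ?P (\<Pi>\<^sub>M i\<in>{..<m}. borel) (compose {..<m} U)) ?S"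
      unfolding G_def law by (simp add: space_PiM)
    also have "\<dots> = \<P>(w in ?P. \<exists>j\<le>m. x < (\<Sum>i<j. U (w i)))"
      using measure_distr[OF mc S] eq by simp
    finally show ?thesis using measurable_sets[OF mc S] eq by simp
  qed
  \<comment> \<open>a common bound for the differences of all partial sums\<close>
  define D where "D k w = (\<Sum>i<m. \<bar>V k (w i) - V' (w i)\<bar>)" for k w
  have [measurable]: "D k \<in> borel_measurable ?P" for k
    unfolding D_def using V(1) V' by (intro borel_measurable_sum borel_measurable_abs borel_measurable_diff comp) auto
  have "(\<lambda>k. \<P>(w in ?P. e < \<bar>D k w - 0\<bar>)) \<longlonglongrightarrow> 0"
  proof (rule P.convergence_in_probability_of_AE[OF _ _ _ \<open>0 < e\<close>])
    show "AE w in ?P. (\<lambda>k. D k w) \<longlonglongrightarrow> 0"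
    proof (rule AE_I2)
      fix w assume "w \<in> space ?P"
      then have "(\<lambda>k. D k w) \<longlonglongrightarrow> (\<Sum>i<m. \<bar>V' (w i) - V' (w i)\<bar>)"
        unfolding D_def by (intro tendsto_intros conv) (auto simp: space_PiM PiE_iff)
      then show "(\<lambda>k. D k w) \<longlonglongrightarrow> 0" by simp
    qed
  qed auto
  from order_tendstoD(2)[OF this \<open>0 < e\<close>] show ?thesis
  proof (eventually_elim, intro allI)
    fix k x
    assume elim: "\<P>(w in ?P. e < \<bar>D k w - 0\<bar>) < e"
    have D0: "0 \<le> D k w" for w unfolding D_def by (intro sum_nonneg) auto
    have close: "\<bar>(\<Sum>i<j. V k (w i)) - (\<Sum>i<j. V' (w i))\<bar> \<le> e" if "j \<le> m" "\<not> e < \<bar>D k w\<bar>" for j w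
    proof -
      have "\<bar>(\<Sum>i<j. V k (w i)) - (\<Sum>i<j. V' (w i))\<bar> \<le> (\<Sum>i<j. \<bar>V k (w i) - V' (w i)\<bar>)"
        unfolding sum_subtractf[symmetric] by (rule sum_abs)
      also have "\<dots> \<le> D k w" unfolding D_def using that by (intro sum_mono2) auto
      finally show ?thesis using that(2) D0[of w] by simp
    qed
    have bad: "{w \<in> space ?P. e < \<bar>D k w\<bar>} \<in> sets ?P" by measurable
    have half: "\<P>(w in ?P. \<exists>j\<le>m. x < (\<Sum>i<j. U1 (w i))) \<le> \<P>(w in ?P. \<exists>j\<le>m. x - e < (\<Sum>i<j. U2 (w i))) + e"
      if U: "U2 \<in> borel_measurable \<Omega>"
        and "\<And>j w. j \<le> m \<Longrightarrow> \<not> e < \<bar>D k w\<bar> \<Longrightarrow> \<bar>(\<Sum>i<j. U1 (w i)) - (\<Sum>i<j. U2 (w i))\<bar> \<le> e" for U1 U2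
    proof -
      have S2: "{w \<in> space ?P. \<exists>j\<le>m. x - e < (\<Sum>i<j. U2 (w i))} \<in> sets ?P"
        using G[OF U] by blast
      have "{w \<in> space ?P. \<exists>j\<le>m. x < (\<Sum>i<j. U1 (w i))} \<subseteq>
          {w \<in> space ?P. \<exists>j\<le>m. x - e < (\<Sum>i<j. U2 (w i))} \<union> {w \<in> space ?P. e < \<bar>D k w\<bar>}"
      proof
        fix w assume "w \<in> {w \<in> space ?P. \<exists>j\<le>m. x < (\<Sum>i<j. U1 (w i))}"
        then obtain j where j: "w \<in> space ?P" "j \<le> m" "x < (\<Sum>i<j. U1 (w i))" by auto
        show "w \<in> {w \<in> space ?P. \<exists>j\<le>m. x - e < (\<Sum>i<j. U2 (w i))} \<union> {w \<in> space ?P. e < \<bar>D k w\<bar>}"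
        proof (cases "e < \<bar>D k w\<bar>")
          case False
          then have "x - e < (\<Sum>i<j. U2 (w i))" using that(2)[OF j(2) False] j(3) by linarith
          then show ?thesis using j by blast
        qed (use j in auto)
      qed
      then have "\<P>(w in ?P. \<exists>j\<le>m. x < (\<Sum>i<j. U1 (w i))) \<le>
          P.prob ({w \<in> space ?P. \<exists>j\<le>m. x - e < (\<Sum>i<j. U2 (w i))} \<union> {w \<in> space ?P. e < \<bar>D k w\<bar>})"
        by (rule P.finite_measure_mono) (rule sets.Un[OF S2 bad])
      also have "\<dots> \<le> \<P>(w in ?P. \<exists>j\<le>m. x - e < (\<Sum>i<j. U2 (w i))) + \<P>(w in ?P. e < \<bar>D k w\<bar>)"
        by (rule measure_Un_le[OF S2 bad])
      also have "\<P>(w in ?P. e < \<bar>D k w\<bar>) \<le> e" using elim by simp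
      finally show ?thesis by simp
    qed
    have G': "G (distr \<Omega> borel U) y = \<P>(w in ?P. \<exists>j\<le>m. y < (\<Sum>i<j. U (w i)))"
      if "U \<in> borel_measurable \<Omega>" for U y
      using G[OF that] by blast
    have close': "\<bar>(\<Sum>i<j. V' (w i)) - (\<Sum>i<j. V k (w i))\<bar> \<le> e" if "j \<le> m" "\<not> e < \<bar>D k w\<bar>" for j w
      using close[OF that] by (simp only: abs_minus_commute)
    show "G (\<mu> k) x \<le> G \<mu>' (x - e) + e \<and> G \<mu>' x \<le> G (\<mu> k) (x - e) + e"
      unfolding V(2)[of k, symmetric] V'd[symmetric] G'[OF V(1)] G'[OF V']
      by (intro conjI half V(1) V' close close')
  qed
qed

section \<open>Levy processes in a domain of attraction\<close>

sublocale levy_process \<subseteq> incr: increment_process M F X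
proof (unfold_locales, goal_cases)
  case (1 t)
  show ?case by (rule space_F)
next
  case (2 t)
  show ?case by (rule sets_F_subset)
next
  case (3 s t)
  then show ?case using sets_F_mono[of s t] by simp
next
  case (4 t)
  then show ?case by (rule adapted)
next
  case (5 \<omega>)
  then show ?case by (rule start_zero)
next
  case (6 \<omega> t)
  then show ?case using cadlag_paths[of \<omega>] unfolding cadlag_def by blast
next
  case (7 s t)
  then show ?case by (rule stationary_increments)
next
  case (8 s t A B)
  have "{\<omega> \<in> space M. X t \<omega> - X s \<omega> \<in> B} = (\<lambda>\<omega>. X t \<omega> - X s \<omega>) -` B \<inter> space M" by auto
  then show ?case using indep_setD[OF independent_increments[OF 8(1,2)] 8(3)] 8(4) by auto
qed

lemma (in levy_process) exponent:
  obtains \<Psi> where "continuous_on UNIV \<Psi>" "\<Psi> 0 = 0"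
    "\<And>t u. 0 \<le> t \<Longrightarrow> char (distr M borel (X t)) u = exp (of_real t * \<Psi> u)"
  using nondeterministic continuous_levy_exponent levy_exponent_0
  unfolding nondeterministic_def has_levy_triplet_def by metis

lemma (in increment_process) scaled:
  assumes "0 < \<kappa>"
  shows "increment_process M (\<lambda>t. F (\<kappa> * t)) (\<lambda>t \<omega>. \<sigma> * Y (\<kappa> * t) \<omega> - c * t)"
proof (unfold_locales, goal_cases)
  case (1 t)
  then show ?case using assms by (intro space_F) auto
next
  case (2 t)
  then show ?case using assms by (intro sets_F) auto
next
  case (3 s t)
  then show ?case using assms by (intro mono_F) auto
next
  case (4 t)
  then have "Y (\<kappa> * t) \<in> borel_measurable (F (\<kappa> * t))" using assms by (intro adapted) auto
  then show ?case by measurable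
next
  case (5 \<omega>)
  then show ?case using start_zero by simp
next
  case (6 \<omega> t)
  have "filterlim (\<lambda>t. \<kappa> * t) (at_right (\<kappa> * t)) (at_right t)"
  proof (subst filterlim_at, intro conjI)
    show "\<forall>\<^sub>F s in at_right t. \<kappa> * s \<in> {\<kappa> * t<..} \<and> \<kappa> * s \<noteq> \<kappa> * t"
      using eventually_at_right_less[of t] by eventually_elim (use assms in auto)
    show "((\<lambda>s. \<kappa> * s) \<longlongrightarrow> \<kappa> * t) (at_right t)" by (intro tendsto_intros)
  qed
  moreover have "((\<lambda>t. Y t \<omega>) \<longlongrightarrow> Y (\<kappa> * t) \<omega>) (at_right (\<kappa> * t))"
    using right_cont[of \<omega> "\<kappa> * t"] 6 assms by (simp add: continuous_within)
  ultimately have "((\<lambda>t. Y (\<kappa> * t) \<omega>) \<longlongrightarrow> Y (\<kappa> * t) \<omega>) (at_right t)"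
    by (rule filterlim_compose[rotated])
  then show ?case unfolding continuous_within by (intro tendsto_intros)
next
  case (7 s t)
  have st: "0 \<le> \<kappa> * s" "\<kappa> * s \<le> \<kappa> * t" "0 \<le> \<kappa> * t" "0 \<le> \<kappa> * t - \<kappa> * s" using 7 assms by (auto simp: mult_nonneg_nonneg)
  note [measurable] = measurable_Y[OF st(1)] measurable_Y[OF st(3)] measurable_Y[OF st(4)]
  have "distr M borel (\<lambda>\<omega>. \<sigma> * Y (\<kappa> * t) \<omega> - c * t - (\<sigma> * Y (\<kappa> * s) \<omega> - c * s))
      = distr (distr M borel (\<lambda>\<omega>. Y (\<kappa> * t) \<omega> - Y (\<kappa> * s) \<omega>)) borel (\<lambda>x. \<sigma> * x - c * (t - s))"
    by (subst distr_distr) (auto simp: comp_def algebra_simps intro!: distr_cong)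
  also have "\<dots> = distr (distr M borel (Y (\<kappa> * t - \<kappa> * s))) borel (\<lambda>x. \<sigma> * x - c * (t - s))"
    unfolding stationary[OF st(1,2)] ..
  also have "\<dots> = distr M borel (\<lambda>\<omega>. \<sigma> * Y (\<kappa> * (t - s)) \<omega> - c * (t - s))"
    by (subst distr_distr) (auto simp: comp_def algebra_simps intro!: distr_cong)
  finally show ?case .
next
  case (8 s t A B)
  have st: "0 \<le> \<kappa> * s" "\<kappa> * s \<le> \<kappa> * t" using 8 assms by (auto simp: mult_nonneg_nonneg)
  define B' where "B' = (\<lambda>x. \<sigma> * x - c * (t - s)) -` B"
  have "(\<lambda>x. \<sigma> * x - c * (t - s)) \<in> borel_measurable borel" by measurable
  from measurable_sets[OF this 8(4)] have "B' \<in> sets borel" by (simp add: B'_def)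
  moreover have "{\<omega> \<in> space M. \<sigma> * Y (\<kappa> * t) \<omega> - c * t - (\<sigma> * Y (\<kappa> * s) \<omega> - c * s) \<in> B}
      = {\<omega> \<in> space M. Y (\<kappa> * t) \<omega> - Y (\<kappa> * s) \<omega> \<in> B'}"
    by (simp add: B'_def algebra_simps)
  ultimately show ?case using indep[OF st 8(3)] by simp
qed

text \<open>
  The hypotheses on \<open>X\<close>, \<open>L\<close> and the norming sequence \<open>d\<close>, together with continuous exponents
  \<open>\<Psi>\<close> of \<open>X\<close> and \<open>\<Lambda>\<close> of \<open>L\<close>. Asymptotic statements about \<open>X\<close> are reduced to statements about
  \<open>\<Psi>\<close>, which is what makes them available at all real times and not only along the integers.
\<close>

locale attracted_levy_process =
  X: levy_process M F X + L: stable_levy_process N G L \<alpha>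
  for M :: "'a measure" and F :: "real \<Rightarrow> 'a measure" and X :: "real \<Rightarrow> 'a \<Rightarrow> real"
    and N :: "'b measure" and G :: "real \<Rightarrow> 'b measure" and L :: "real \<Rightarrow> 'b \<Rightarrow> real" and \<alpha> :: real +
  fixes d :: "nat \<Rightarrow> real" and \<Psi> \<Lambda> :: "real \<Rightarrow> complex"
  assumes alpha_gt_1: "1 < \<alpha>"
    and d_pos: "\<And>k. 1 \<le> k \<Longrightarrow> 0 < d k"
    and attraction: "weak_conv_m (\<lambda>k. distr M borel (\<lambda>\<omega>. X (real k) \<omega> / d k)) (distr N borel (L 1))"
    and cont_Psi: "continuous_on UNIV \<Psi>" and Psi_0: "\<Psi> 0 = 0"
    and char_X: "\<And>t u. 0 \<le> t \<Longrightarrow> char (distr M borel (X t)) u = exp (of_real t * \<Psi> u)"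
    and cont_Lambda: "continuous_on UNIV \<Lambda>" and Lambda_0: "\<Lambda> 0 = 0"
    and char_L: "\<And>t u. 0 \<le> t \<Longrightarrow> char (distr N borel (L t)) u = exp (of_real t * \<Lambda> u)"

lemma (in prob_space) char_affine:
  assumes [measurable]: "V \<in> borel_measurable M"
  shows "char (distr M borel (\<lambda>\<omega>. \<sigma> * V \<omega> - c)) u = char (distr M borel V) (\<sigma> * u) * iexp (- (u * c))"
proof -
  have "char (distr M borel (\<lambda>\<omega>. \<sigma> * V \<omega> - c)) u = (CLINT \<omega>|M. iexp (u * (\<sigma> * V \<omega> - c)))"
    unfolding char_def by (subst integral_distr) auto
  also have "\<dots> = (CLINT \<omega>|M. iexp (\<sigma> * u * V \<omega>) * iexp (- (u * c)))"
    by (intro Bochner_Integration.integral_cong refl) (simp add: exp_add[symmetric] algebra_simps)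
  also have "\<dots> = (CLINT \<omega>|M. iexp (\<sigma> * u * V \<omega>)) * iexp (- (u * c))"
    by simp
  also have "(CLINT \<omega>|M. iexp (\<sigma> * u * V \<omega>)) = char (distr M borel V) (\<sigma> * u)"
    unfolding char_def by (subst integral_distr) auto
  finally show ?thesis .
qed

context attracted_levy_process
begin

lemma exponent_uniform_limit:
  assumes "0 \<le> K"
  shows "uniform_limit {-K..K} (\<lambda>n u. of_nat n * \<Psi> (u / d n)) \<Lambda> sequentially"
proof (rule uniform_limit_of_exp[OF assms])
  show "continuous_on {-K..K} (\<lambda>u. of_nat n * \<Psi> (u / d n))" for n
    unfolding divide_inverse
    by (intro continuous_intros continuous_on_compose2[OF cont_Psi]) auto
  show "continuous_on {-K..K} \<Lambda>" using cont_Lambda by (rule continuous_on_subset) auto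
  have 1: "char (distr M borel (\<lambda>\<omega>. X (real n) \<omega> / d n)) u = exp (of_nat n * \<Psi> (u / d n))" for n u
    using X.char_affine[OF X.incr.measurable_Y, of "real n" "1 / d n" 0 u] char_X[of "real n" "u / d n"] by simp
  have 2: "char (distr N borel (L 1)) u = exp (\<Lambda> u)" for u
    using char_L[of 1 u] by simp
  have "uniform_limit {-K..K} (\<lambda>n. char (distr M borel (\<lambda>\<omega>. X (real n) \<omega> / d n))) (char (distr N borel (L 1))) sequentially"
    by (intro uniform_limit_char attraction X.real_distribution_distr L.real_distribution_distr
        borel_measurable_divide X.incr.measurable_Y L.incr.measurable_Y) auto
  then show "uniform_limit {-K..K} (\<lambda>n u. exp (of_nat n * \<Psi> (u / d n))) (\<lambda>u. exp (\<Lambda> u)) sequentially"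
    unfolding 1 2 .
qed (simp_all add: Psi_0 Lambda_0)

text \<open>
  Uniformity on compact sets allows the argument to vary with the index, which is needed to compare
  the scales \<open>d (2 * n)\<close> and \<open>d n\<close>.
\<close>

lemma exponent_tendsto:
  assumes k: "filterlim k at_top sequentially" and v: "v \<longlonglongrightarrow> w"
  shows "(\<lambda>i. of_nat (k i) * \<Psi> (v i / d (k i))) \<longlonglongrightarrow> \<Lambda> w"
proof -
  have "Bseq v" using v convergentI convergent_imp_Bseq by blast
  then obtain K where K: "0 < K" "\<And>i. \<bar>v i\<bar> \<le> K" by (auto simp: Bseq_def)
  have in_K: "v i \<in> {-K..K}" for i using K(2)[of i] by (simp add: abs_le_iff)
  have "(\<lambda>i. of_nat (k i) * \<Psi> (v i / d (k i)) - \<Lambda> (v i)) \<longlonglongrightarrow> 0"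
  proof (rule tendstoI)
    fix e :: real assume "0 < e"
    have "\<forall>\<^sub>F n in sequentially. \<forall>u\<in>{-K..K}. dist (of_nat n * \<Psi> (u / d n)) (\<Lambda> u) < e"
      using uniform_limitD[OF exponent_uniform_limit \<open>0 < e\<close>] K(1) by auto
    then have "\<forall>\<^sub>F i in sequentially. \<forall>u\<in>{-K..K}. dist (of_nat (k i) * \<Psi> (u / d (k i))) (\<Lambda> u) < e"
      using k by (rule eventually_compose_filterlim)
    then show "\<forall>\<^sub>F i in sequentially. dist (of_nat (k i) * \<Psi> (v i / d (k i)) - \<Lambda> (v i)) 0 < e"
      by eventually_elim (use in_K in \<open>simp add: dist_norm\<close>)
  qed
  moreover have "(\<lambda>i. \<Lambda> (v i)) \<longlonglongrightarrow> \<Lambda> w"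
    using cont_Lambda v by (intro isCont_tendsto_compose[of _ \<Lambda>]) (auto simp: continuous_on_eq_continuous_at)
  ultimately show ?thesis using tendsto_add by fastforce
qed

text \<open>
  The exponent of \<open>h * X (k t) / d k\<close> at \<open>u\<close> is \<open>t * (k * \<Psi> (h * u / d k))\<close>. It vanishes in the limit
  if the time \<open>t\<close> does, the second factor being bounded, and also if the factor \<open>h\<close> does, since then
  the second factor tends to \<open>\<Lambda> 0 = 0\<close>. The first case says that little happens in short times, the
  second one is tightness.
\<close>

lemma scaled_concentration:
  fixes t h :: "nat \<Rightarrow> real"
  assumes k: "filterlim k at_top sequentially" and t: "\<And>i. t i \<in> {0..1}" and h: "\<And>i. h i \<in> {0..1}"
    and th: "t \<longlonglongrightarrow> 0 \<or> h \<longlonglongrightarrow> 0" and "0 < e"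
  shows "(\<lambda>i. \<P>(\<omega> in M. e < \<bar>h i / d (k i) * X (real (k i) * t i) \<omega>\<bar>)) \<longlonglongrightarrow> 0"
proof -
  let ?\<mu> = "\<lambda>i. distr M borel (\<lambda>\<omega>. h i / d (k i) * X (real (k i) * t i) \<omega>)"
  have m[measurable]: "X (real (k i) * t i) \<in> borel_measurable M" for i
    using t[of i] by (intro X.incr.measurable_Y) auto
  have char_eq: "char (?\<mu> i) u = exp (of_real (t i) * (of_nat (k i) * \<Psi> (h i * u / d (k i))))" for i u
    using X.char_affine[OF m[of i], of "h i / d (k i)" 0 u] char_X[of "real (k i) * t i" "h i * u / d (k i)"] t[of i]
    by (simp add: ac_simps)
  have "(\<lambda>i. of_real (t i) * (of_nat (k i) * \<Psi> (h i * u / d (k i)))) \<longlonglongrightarrow> 0" for u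
  proof (cases "h \<longlonglongrightarrow> 0")
    case True
    have "(\<lambda>i. of_nat (k i) * \<Psi> (h i * u / d (k i))) \<longlonglongrightarrow> \<Lambda> (0 * u)"
      by (intro exponent_tendsto k tendsto_mult True tendsto_const)
    then have "(\<lambda>i. of_nat (k i) * \<Psi> (h i * u / d (k i))) \<longlonglongrightarrow> 0" by (simp add: Lambda_0)
    moreover have "Bfun (\<lambda>i. of_real (t i) :: complex) sequentially"
      using t by (intro BfunI[of _ 1]) auto
    ultimately show ?thesis
      using bounded_bilinear.Bfun_prod_Zfun[OF bounded_bilinear_mult] by (auto simp: tendsto_Zfun_iff)
  next
    case False
    then have t0: "t \<longlonglongrightarrow> 0" using th by simp
    have "uniform_limit {-\<bar>u\<bar>..\<bar>u\<bar>} (\<lambda>n u. of_nat n * \<Psi> (u / d n)) \<Lambda> sequentially"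
      by (rule exponent_uniform_limit) simp
    from uniform_limitD[OF this, of 1]
    have "\<forall>\<^sub>F n in sequentially. \<forall>v\<in>{-\<bar>u\<bar>..\<bar>u\<bar>}. dist (of_nat n * \<Psi> (v / d n)) (\<Lambda> v) < 1" by simp
    then have ev: "\<forall>\<^sub>F i in sequentially. \<forall>v\<in>{-\<bar>u\<bar>..\<bar>u\<bar>}. dist (of_nat (k i) * \<Psi> (v / d (k i))) (\<Lambda> v) < 1"
      using k by (rule eventually_compose_filterlim)
    have "compact (\<Lambda> ` {-\<bar>u\<bar>..\<bar>u\<bar>})"
      by (intro compact_continuous_image continuous_on_subset[OF cont_Lambda]) auto
    then obtain B where B: "\<And>v. v \<in> {-\<bar>u\<bar>..\<bar>u\<bar>} \<Longrightarrow> cmod (\<Lambda> v) \<le> B"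
      by (metis compact_imp_bounded bounded_iff image_eqI)
    have "Bfun (\<lambda>i. of_nat (k i) * \<Psi> (h i * u / d (k i))) sequentially"
    proof (rule BfunI[of _ "1 + B"], use ev in eventually_elim)
      case (elim i)
      have hu: "h i * u \<in> {-\<bar>u\<bar>..\<bar>u\<bar>}"
      proof -
        have "\<bar>h i * u\<bar> \<le> 1 * \<bar>u\<bar>" unfolding abs_mult using h[of i] by (intro mult_right_mono) auto
        then show ?thesis by (simp add: abs_le_iff)
      qed
      then have "dist (of_nat (k i) * \<Psi> (h i * u / d (k i))) (\<Lambda> (h i * u)) < 1" using elim by blast
      then show ?case
        using B[OF hu] norm_triangle_sub[of "of_nat (k i) * \<Psi> (h i * u / d (k i))" "\<Lambda> (h i * u)"]
        by (simp add: dist_norm)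
    qed
    moreover have "(\<lambda>i. of_real (t i) :: complex) \<longlonglongrightarrow> 0"
      using tendsto_of_real[OF t0] by simp
    ultimately show ?thesis
      using bounded_bilinear.Zfun_prod_Bfun[OF bounded_bilinear_mult] by (auto simp: tendsto_Zfun_iff)
  qed
  then have "(\<lambda>i. char (?\<mu> i) u) \<longlonglongrightarrow> 1" for u
    unfolding char_eq using tendsto_exp[of _ 0] by fastforce
  then have "(\<lambda>i. measure (?\<mu> i) {x. e < \<bar>x\<bar>}) \<longlonglongrightarrow> 0"
    using \<open>0 < e\<close> by (intro concentration_if_char_tendsto_1 X.real_distribution_distr) auto
  moreover have "measure (?\<mu> i) {x. e < \<bar>x\<bar>} = \<P>(\<omega> in M. e < \<bar>h i / d (k i) * X (real (k i) * t i) \<omega>\<bar>)" for i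
    by (subst measure_distr) (auto simp: vimage_def Int_def conj_commute)
  ultimately show ?thesis by simp
qed

lemma uniformly_tight:
  obtains A n\<^sub>0 where "0 < A" "1 \<le> n\<^sub>0"
    "\<And>n t. n\<^sub>0 \<le> n \<Longrightarrow> 0 \<le> t \<Longrightarrow> t \<le> real n \<Longrightarrow> \<P>(\<omega> in M. A * d n < \<bar>X t \<omega>\<bar>) \<le> 1 / 4"
proof -
  have "\<exists>A n\<^sub>0. 0 < A \<and> 1 \<le> n\<^sub>0 \<and>
    (\<forall>n\<ge>n\<^sub>0. \<forall>t. 0 \<le> t \<longrightarrow> t \<le> real n \<longrightarrow> \<P>(\<omega> in M. A * d n < \<bar>X t \<omega>\<bar>) \<le> 1 / 4)"
  proof (rule ccontr)
    assume neg: "\<not> ?thesis"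
    have "\<forall>i. \<exists>n t. Suc i \<le> n \<and> 0 \<le> t \<and> t \<le> real n \<and> 1 / 4 < \<P>(\<omega> in M. real (Suc i) * d n < \<bar>X t \<omega>\<bar>)"
    proof
      fix i :: nat
      have "0 < real (Suc i)" "1 \<le> Suc i" by simp_all
      then show "\<exists>n t. Suc i \<le> n \<and> 0 \<le> t \<and> t \<le> real n \<and> 1 / 4 < \<P>(\<omega> in M. real (Suc i) * d n < \<bar>X t \<omega>\<bar>)"
        using neg unfolding not_le[symmetric] by blast
    qed
    from choice[OF this] obtain k where
      "\<forall>i. \<exists>t. Suc i \<le> k i \<and> 0 \<le> t \<and> t \<le> real (k i) \<and> 1 / 4 < \<P>(\<omega> in M. real (Suc i) * d (k i) < \<bar>X t \<omega>\<bar>)" ..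
    from choice[OF this] obtain t where kt: "\<And>i. Suc i \<le> k i" "\<And>i. 0 \<le> t i" "\<And>i. t i \<le> real (k i)"
      "\<And>i. 1 / 4 < \<P>(\<omega> in M. real (Suc i) * d (k i) < \<bar>X (t i) \<omega>\<bar>)" by blast
    have k_inf: "filterlim k at_top sequentially"
      using kt(1) by (intro filterlim_at_top_mono[OF filterlim_Suc]) auto
    have k0: "0 < real (k i)" "0 < d (k i)" for i using kt(1)[of i] d_pos[of "k i"] by auto
    have "(\<lambda>i. \<P>(\<omega> in M. 1 < \<bar>1 / real (Suc i) / d (k i) * X (real (k i) * (t i / real (k i))) \<omega>\<bar>)) \<longlonglongrightarrow> 0"
    proof (rule scaled_concentration[OF k_inf])
      show "(\<lambda>i. t i / real (k i)) \<longlonglongrightarrow> 0 \<or> (\<lambda>i. 1 / real (Suc i)) \<longlonglongrightarrow> 0"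
        using LIMSEQ_inverse_real_of_nat by (simp add: inverse_eq_divide)
      show "t i / real (k i) \<in> {0..1}" for i using k0[of i] kt(2,3)[of i] by simp
    qed auto
    moreover have "\<P>(\<omega> in M. 1 < \<bar>1 / real (Suc i) / d (k i) * X (real (k i) * (t i / real (k i))) \<omega>\<bar>) =
        \<P>(\<omega> in M. real (Suc i) * d (k i) < \<bar>X (t i) \<omega>\<bar>)" for i
      using k0[of i] by (simp add: abs_mult field_simps del: of_nat_Suc)
    ultimately have "\<forall>\<^sub>F i in sequentially. \<P>(\<omega> in M. real (Suc i) * d (k i) < \<bar>X (t i) \<omega>\<bar>) < 1 / 4"
      by (intro order_tendstoD(2)[of _ 0]) auto
    then have "\<forall>\<^sub>F i :: nat in sequentially. False"
    proof eventually_elim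
      case (elim i)
      then show False using kt(4)[of i] by linarith
    qed
    then show False by simp
  qed
  then show ?thesis using that by blast
qed

lemma small_times:
  assumes "0 < e" "0 < \<eta>"
  obtains i n\<^sub>0 where "1 \<le> n\<^sub>0"
    "\<And>n s. n\<^sub>0 \<le> n \<Longrightarrow> 0 \<le> s \<Longrightarrow> s \<le> 1 / 2 ^ i \<Longrightarrow> \<P>(\<omega> in M. e * d n < \<bar>X (real n * s) \<omega>\<bar>) \<le> \<eta>"
proof -
  have "\<exists>i n\<^sub>0. 1 \<le> n\<^sub>0 \<and>
    (\<forall>n\<ge>n\<^sub>0. \<forall>s. 0 \<le> s \<longrightarrow> s \<le> 1 / 2 ^ i \<longrightarrow> \<P>(\<omega> in M. e * d n < \<bar>X (real n * s) \<omega>\<bar>) \<le> \<eta>)"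
  proof (rule ccontr)
    assume neg: "\<not> ?thesis"
    have "\<forall>i. \<exists>n s. Suc i \<le> n \<and> 0 \<le> s \<and> s \<le> 1 / 2 ^ i \<and> \<eta> < \<P>(\<omega> in M. e * d n < \<bar>X (real n * s) \<omega>\<bar>)"
    proof
      fix i :: nat
      have "1 \<le> Suc i" by simp
      then show "\<exists>n s. Suc i \<le> n \<and> 0 \<le> s \<and> s \<le> 1 / 2 ^ i \<and> \<eta> < \<P>(\<omega> in M. e * d n < \<bar>X (real n * s) \<omega>\<bar>)"
        using neg unfolding not_le[symmetric] by blast
    qed
    from choice[OF this] obtain k where
      "\<forall>i. \<exists>s. Suc i \<le> k i \<and> 0 \<le> s \<and> s \<le> 1 / 2 ^ i \<and> \<eta> < \<P>(\<omega> in M. e * d (k i) < \<bar>X (real (k i) * s) \<omega>\<bar>)" ..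
    from choice[OF this] obtain s where ks: "\<And>i. Suc i \<le> k i" "\<And>i. 0 \<le> s i" "\<And>i. s i \<le> 1 / 2 ^ i"
      "\<And>i. \<eta> < \<P>(\<omega> in M. e * d (k i) < \<bar>X (real (k i) * s i) \<omega>\<bar>)" by blast
    have k_inf: "filterlim k at_top sequentially"
      using ks(1) by (intro filterlim_at_top_mono[OF filterlim_Suc]) auto
    have k0: "0 < real (k i)" "0 < d (k i)" for i using ks(1)[of i] d_pos[of "k i"] by auto
    have lim2: "(\<lambda>i. 1 / 2 ^ i :: real) \<longlonglongrightarrow> 0"
      using LIMSEQ_inverse_realpow_zero[of 2] by (simp add: inverse_eq_divide)
    have s0: "s \<longlonglongrightarrow> 0"
      by (rule tendsto_sandwich[OF _ _ tendsto_const lim2]) (use ks in auto)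
    have "(\<lambda>i. \<P>(\<omega> in M. e < \<bar>1 / d (k i) * X (real (k i) * s i) \<omega>\<bar>)) \<longlonglongrightarrow> 0"
    proof (rule scaled_concentration[OF k_inf])
      show "s i \<in> {0..1}" for i
        using ks(2,3)[of i] order_trans[of "s i" "1 / 2 ^ i" 1] by simp
    qed (use s0 \<open>0 < e\<close> in auto)
    moreover have "\<P>(\<omega> in M. e < \<bar>1 / d (k i) * X (real (k i) * s i) \<omega>\<bar>) =
        \<P>(\<omega> in M. e * d (k i) < \<bar>X (real (k i) * s i) \<omega>\<bar>)" for i
      using k0[of i] by (simp add: abs_mult field_simps)
    ultimately have "\<forall>\<^sub>F i in sequentially. \<P>(\<omega> in M. e * d (k i) < \<bar>X (real (k i) * s i) \<omega>\<bar>) < \<eta>"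
      using \<open>0 < \<eta>\<close> by (intro order_tendstoD(2)[of _ 0]) auto
    then have "\<forall>\<^sub>F i :: nat in sequentially. False"
    proof eventually_elim
      case (elim i)
      then show False using ks(4)[of i] by linarith
    qed
    then show False by simp
  qed
  then show ?thesis using that by blast
qed

section \<open>Growth of the norming sequence and uniform tails\<close>

text \<open>
  Taking moduli of characteristic functions removes the unknown centering constant in the definition
  of stability.
\<close>

lemma Re_Lambda_stable: "Re (\<Lambda> (2 powr (1 / \<alpha>) * u)) = 2 * Re (\<Lambda> u)"
proof -
  let ?\<mu> = "distr N borel (L 1)"
  let ?c = "2 powr (1 / \<alpha>)"
  have [measurable]: "L 1 \<in> borel_measurable N" by (rule L.incr.measurable_Y) simp
  have \<mu>: "real_distribution ?\<mu>" by (intro L.real_distribution_distr) measurable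
  interpret \<mu>: real_distribution ?\<mu> by (rule \<mu>)
  interpret P: pair_prob_space ?\<mu> ?\<mu> by unfold_locales
  have "\<forall>A>0. \<forall>B>0. \<exists>D. distr (?\<mu> \<Otimes>\<^sub>M ?\<mu>) borel (\<lambda>(y, z). A * y + B * z) =
        distr ?\<mu> borel (\<lambda>y. (A powr \<alpha> + B powr \<alpha>) powr (1 / \<alpha>) * y + D)"
    using L.stable unfolding stable_law_def by blast
  from this[rule_format, of 1 1] obtain D where
    D: "distr (?\<mu> \<Otimes>\<^sub>M ?\<mu>) borel (\<lambda>(y, z). y + z) = distr ?\<mu> borel (\<lambda>y. ?c * y + D)"
    by auto
  have i: "integrable (?\<mu> \<Otimes>\<^sub>M ?\<mu>) (\<lambda>(y, z). iexp (u * (y + z)))"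
    by (subst case_prod_beta', intro P.integrable_iexp) auto
  have "char (distr (?\<mu> \<Otimes>\<^sub>M ?\<mu>) borel (\<lambda>(y, z). y + z)) u = (CLINT p|?\<mu> \<Otimes>\<^sub>M ?\<mu>. case p of (y, z) \<Rightarrow> iexp (u * (y + z)))"
    unfolding char_def by (subst integral_distr) (auto simp: case_prod_beta')
  also have "\<dots> = (CLINT y|?\<mu>. CLINT z|?\<mu>. iexp (u * (y + z)))"
    using P.integral_fst[OF i] by simp
  also have "\<dots> = (CLINT y|?\<mu>. CLINT z|?\<mu>. iexp (u * y) * iexp (u * z))"
    by (intro Bochner_Integration.integral_cong refl) (simp add: exp_add[symmetric] algebra_simps)
  also have "\<dots> = char ?\<mu> u * char ?\<mu> u"
    unfolding char_def by simp
  finally have 1: "char (distr (?\<mu> \<Otimes>\<^sub>M ?\<mu>) borel (\<lambda>(y, z). y + z)) u = char ?\<mu> u * char ?\<mu> u" .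
  have "char (distr ?\<mu> borel (\<lambda>y. ?c * y - (- D))) u = char (distr ?\<mu> borel (\<lambda>y. y)) (?c * u) * iexp (- (u * - D))"
    by (rule \<mu>.char_affine) auto
  then have 2: "char (distr ?\<mu> borel (\<lambda>y. ?c * y + D)) u = char ?\<mu> (?c * u) * iexp (u * D)"
    by (simp add: distr_id2)
  have "char ?\<mu> u * char ?\<mu> u = char ?\<mu> (?c * u) * iexp (u * D)"
    using D 1 2 by simp
  then have "cmod (char ?\<mu> u * char ?\<mu> u) = cmod (char ?\<mu> (?c * u))" by (simp add: norm_mult)
  then have "exp (Re (\<Lambda> u)) * exp (Re (\<Lambda> u)) = exp (Re (\<Lambda> (?c * u)))"
    using char_L[of 1] by (simp add: norm_mult)
  then have "Re (\<Lambda> u) + Re (\<Lambda> u) = Re (\<Lambda> (?c * u))"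
    by (simp only: exp_add[symmetric] exp_inj_iff)
  then show ?thesis by simp
qed

text \<open>
  Otherwise \<open>d n / d (2 * n)\<close> has a limit point \<open>l\<close> with \<open>2 powr (1 / \<alpha>) * l < 1\<close>. Computing the
  limit of \<open>X (2 * n)\<close> at both scales gives \<open>\<Lambda> u = 2 * \<Lambda> (l * u)\<close>. By stability the real part of
  \<open>\<Lambda>\<close> is then unchanged when \<open>u\<close> is multiplied by \<open>2 powr (1 / \<alpha>) * l\<close>, hence zero by iteration, and
  the stable law would be a point mass.
\<close>

lemma doubling:
  obtains \<beta> n\<^sub>0 where "0 < \<beta>" "\<beta> < 1" "1 \<le> n\<^sub>0" "\<And>n. n\<^sub>0 \<le> n \<Longrightarrow> d (2 * n) \<le> 2 powr \<beta> * d n"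
proof -
  \<comment> \<open>any number strictly between \<open>1 / \<alpha>\<close> and \<open>1\<close> would do\<close>
  define \<beta> where "\<beta> = (1 / \<alpha> + 1) / 2"
  have \<beta>: "0 < \<beta>" "\<beta> < 1" "1 / \<alpha> < \<beta>" using alpha_gt_1 by (auto simp: \<beta>_def field_simps)
  have "\<exists>n\<^sub>0\<ge>1. \<forall>n\<ge>n\<^sub>0. d (2 * n) \<le> 2 powr \<beta> * d n"
  proof (rule ccontr)
    assume neg: "\<not> ?thesis"
    have "\<forall>i. \<exists>n. Suc i \<le> n \<and> 2 powr \<beta> * d n < d (2 * n)"
    proof
      fix i :: nat
      have "1 \<le> Suc i" by simp
      then show "\<exists>n. Suc i \<le> n \<and> 2 powr \<beta> * d n < d (2 * n)"
        using neg unfolding not_le[symmetric] by blast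
    qed
    from choice[OF this] obtain k where k: "\<And>i. Suc i \<le> k i" "\<And>i. 2 powr \<beta> * d (k i) < d (2 * k i)" by blast
    have d_k: "0 < d (k i)" "0 < d (2 * k i)" for i
      using k(1)[of i] d_pos[of "k i"] d_pos[of "2 * k i"] by auto
    define q where "q i = d (k i) / d (2 * k i)" for i
    have q: "q i \<in> {0..2 powr (- \<beta>)}" for i
      using d_k[of i] k(2)[of i] unfolding q_def by (auto simp: powr_minus field_simps)
    obtain l r where lr: "l \<in> {0..2 powr (- \<beta>)}" "strict_mono r" "(q \<circ> r) \<longlonglongrightarrow> l"
      using compact_imp_seq_compact[OF compact_Icc, of 0 "2 powr (- \<beta>)"] q
      unfolding seq_compact_def by metis
    have "filterlim k at_top sequentially"
      using k(1) by (intro filterlim_at_top_mono[OF filterlim_Suc]) auto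
    then have kr: "filterlim (\<lambda>i. k (r i)) at_top sequentially"
      using filterlim_subseq[OF lr(2)] by (rule filterlim_compose)
    then have kr2: "filterlim (\<lambda>i. 2 * k (r i)) at_top sequentially"
      by (rule filterlim_at_top_mono) auto
    \<comment> \<open>the same exponents seen at the scales \<open>d (2 n)\<close> and \<open>d n\<close>\<close>
    have half: "\<Lambda> u = 2 * \<Lambda> (l * u)" for u
    proof -
      have lim2: "(\<lambda>i. of_nat (2 * k (r i)) * \<Psi> (u / d (2 * k (r i)))) \<longlonglongrightarrow> \<Lambda> u"
        using exponent_tendsto[OF kr2 tendsto_const] .
      have lim: "(\<lambda>i. 2 * (of_nat (k (r i)) * \<Psi> ((q \<circ> r) i * u / d (k (r i))))) \<longlonglongrightarrow> 2 * \<Lambda> (l * u)"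
        by (intro tendsto_mult tendsto_const exponent_tendsto kr lr(3))
      have eq: "2 * (of_nat (k (r i)) * \<Psi> ((q \<circ> r) i * u / d (k (r i)))) = of_nat (2 * k (r i)) * \<Psi> (u / d (2 * k (r i)))" for i
      proof -
        have "(q \<circ> r) i * u / d (k (r i)) = u / d (2 * k (r i))"
          using d_k[of "r i"] by (simp add: q_def)
        then show ?thesis by simp
      qed
      show ?thesis using LIMSEQ_unique[OF lim2 lim[unfolded eq]] .
    qed
    define \<theta> where "\<theta> = 2 powr (1 / \<alpha>) * l"
    have \<theta>: "0 \<le> \<theta>" "\<theta> < 1"
    proof -
      show "0 \<le> \<theta>" using lr(1) by (simp add: \<theta>_def)
      have "\<theta> \<le> 2 powr (1 / \<alpha>) * 2 powr (- \<beta>)"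
        unfolding \<theta>_def using lr(1) by (intro mult_left_mono) auto
      also have "\<dots> = 2 powr (1 / \<alpha> - \<beta>)" by (simp add: powr_add[symmetric])
      also have "\<dots> < 2 powr 0" using \<beta> by (intro powr_less_mono) auto
      finally show "\<theta> < 1" by simp
    qed
    have step: "Re (\<Lambda> u) = Re (\<Lambda> (\<theta> * u))" for u
      using half[of u] Re_Lambda_stable[of "l * u"] by (simp add: \<theta>_def mult.assoc)
    have iter: "Re (\<Lambda> u) = Re (\<Lambda> (\<theta> ^ j * u))" for j u
      by (induction j) (use step in \<open>auto simp: mult.assoc\<close>)
    have "Re (\<Lambda> u) = 0" for u
    proof -
      have "(\<lambda>j. \<theta> ^ j * u) \<longlonglongrightarrow> 0 * u"
        using \<theta> by (intro tendsto_mult LIMSEQ_realpow_zero tendsto_const) auto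
      then have "(\<lambda>j. Re (\<Lambda> (\<theta> ^ j * u))) \<longlonglongrightarrow> Re (\<Lambda> (0 * u))"
        using cont_Lambda
        by (intro tendsto_Re isCont_tendsto_compose[of _ \<Lambda>]) (auto simp: continuous_on_eq_continuous_at)
      then have "(\<lambda>j. Re (\<Lambda> u)) \<longlonglongrightarrow> 0" unfolding iter[symmetric] by (simp add: Lambda_0)
      then show ?thesis using LIMSEQ_unique tendsto_const by blast
    qed
    then have "cmod (char (distr N borel (L 1)) u) = 1" for u
      using char_L[of 1 u] by simp
    then have "\<exists>c. AE x in distr N borel (L 1). x = c"
      by (intro AE_const_if_cmod_char_eq_1 L.real_distribution_distr L.incr.measurable_Y) auto
    then show False using L.stable unfolding stable_law_def by blast
  qed
  then show ?thesis using that \<beta> by blast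
qed

text \<open>
  Growth and tightness, here with a common threshold \<open>n\<^sub>0\<close>, imply the tail bound: the largest
  increment over \<open>K\<close> blocks of length \<open>n\<close> is at most twice the largest absolute value of the process
  up to time \<open>K * n\<close>, and by Ottaviani's inequality the latter is of the order of \<open>d (K * n)\<close>. So a
  single increment exceeds a multiple of \<open>d (K * n)\<close> with probability at most \<open>2 / K\<close>. Now let \<open>K\<close>
  run through the powers of \<open>2\<close>.
\<close>

lemma power_tail:
  obtains A C \<beta> n\<^sub>0 where "0 < A" "0 < C" "0 < \<beta>" "\<beta> < 1" "1 \<le> n\<^sub>0"
    "\<And>n j. n\<^sub>0 \<le> n \<Longrightarrow> d (2 ^ j * n) \<le> 2 powr (\<beta> * real j) * d n"
    "\<And>n t. n\<^sub>0 \<le> n \<Longrightarrow> 0 \<le> t \<Longrightarrow> t \<le> real n \<Longrightarrow> \<P>(\<omega> in M. A * d n < \<bar>X t \<omega>\<bar>) \<le> 1 / 4"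
    "\<And>n y. n\<^sub>0 \<le> n \<Longrightarrow> 0 < y \<Longrightarrow> \<P>(\<omega> in M. y * d n < \<bar>X (real n) \<omega>\<bar>) \<le> C * y powr (- 1 / \<beta>)"
proof -
  obtain A n\<^sub>1 where A: "0 < A" "1 \<le> n\<^sub>1"
    and tight: "\<And>n t. n\<^sub>1 \<le> n \<Longrightarrow> 0 \<le> t \<Longrightarrow> t \<le> real n \<Longrightarrow> \<P>(\<omega> in M. A * d n < \<bar>X t \<omega>\<bar>) \<le> 1 / 4"
    using uniformly_tight by blast
  obtain \<beta> n\<^sub>2 where \<beta>: "0 < \<beta>" "\<beta> < 1" "1 \<le> n\<^sub>2" and dbl: "\<And>n. n\<^sub>2 \<le> n \<Longrightarrow> d (2 * n) \<le> 2 powr \<beta> * d n"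
    using doubling by blast
  define n\<^sub>0 where "n\<^sub>0 = max n\<^sub>1 n\<^sub>2"
  have n0: "1 \<le> n\<^sub>0" "n\<^sub>1 \<le> n\<^sub>0" "n\<^sub>2 \<le> n\<^sub>0" using A by (auto simp: n\<^sub>0_def)
  have dyadic: "d (2 ^ j * n) \<le> 2 powr (\<beta> * real j) * d n" if n: "n\<^sub>0 \<le> n" for n j
  proof (induction j)
    case (Suc j)
    have "n\<^sub>2 * 1 \<le> n * 2 ^ j" using n n0 by (intro mult_le_mono) auto
    then have "n\<^sub>2 \<le> 2 ^ j * n" by (simp add: mult.commute)
    then have "d (2 * (2 ^ j * n)) \<le> 2 powr \<beta> * d (2 ^ j * n)" by (rule dbl)
    also have "\<dots> \<le> 2 powr \<beta> * (2 powr (\<beta> * real j) * d n)" using Suc by (intro mult_left_mono) auto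
    also have "\<dots> = 2 powr (\<beta> * real (Suc j)) * d n" by (simp add: powr_add algebra_simps)
    finally show ?case by (simp add: mult.assoc)
  qed simp
  have Xm[measurable]: "X (real n) \<in> borel_measurable M" for n by (intro X.incr.measurable_Y) simp
  have block: "\<P>(\<omega> in M. 4 * A * d (K * n) < \<bar>X (real n) \<omega>\<bar>) * real K \<le> 2" if n: "n\<^sub>0 \<le> n" and K: "1 \<le> K" for n K
  proof -
    define a where "a = A * d (K * n)"
    define p where "p = \<P>(\<omega> in M. 4 * a < \<bar>X (real n) \<omega>\<bar>)"
    have "1 \<le> n" using n n0 by simp
    have Kn: "n\<^sub>1 \<le> K * n" "1 \<le> K * n"
      using n n0 K mult_le_mono[of 1 K n\<^sub>1 n] mult_le_mono[of 1 K 1 n] by auto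
    have a: "0 < a" using A d_pos[OF Kn(2)] by (simp add: a_def)
    have T: "\<P>(\<omega> in M. a < \<bar>X t \<omega>\<bar>) \<le> 1 / 4" if "0 \<le> t" "t \<le> real (K * n)" for t
      unfolding a_def using tight[OF Kn(1) that] .
    \<comment> \<open>Ottaviani's inequality for \<open>X\<close> and \<open>- X\<close>, with a coarse grid that consists of the two end points\<close>
    have sup: "{\<omega> \<in> space M. \<exists>t\<in>{0..real (K * n)}. 2 * a < s * X t \<omega>} \<in> X.events \<and>
        \<P>(\<omega> in M. \<exists>t\<in>{0..real (K * n)}. 2 * a < s * X t \<omega>) \<le> 1 / 3" if s: "s = 1 \<or> s = -1" for s
    proof -
      interpret S: increment_process M "\<lambda>t. F (1 * t)" "\<lambda>t \<omega>. s * X (1 * t) \<omega> - 0 * t"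
        by (rule X.incr.scaled) simp
      have m: "X t \<in> borel_measurable M" if "0 \<le> t" for t using that by (rule X.incr.measurable_Y)
      have abs_bound: "\<P>(\<omega> in M. P (X t \<omega>)) \<le> 1 / 4"
        if "0 \<le> t" "t \<le> real (K * n)" "\<And>x. P x \<Longrightarrow> a < \<bar>x\<bar>" for t P
        using m[OF that(1)] that(3) by (intro order_trans[OF X.finite_measure_mono T[OF that(1,2)]]) auto
      have small: "\<P>(\<omega> in M. s * X (1 * t) \<omega> - 0 * t < - a) \<le> 1 / 4" if "0 \<le> t" "t \<le> real (K * n)" for t
        using abs_bound[OF that, of "\<lambda>x. s * x < - a"] s by auto
      have "0 < real (K * n)" using Kn by linarith
      note ott = S.Ottaviani[OF this small, of 1 a]
      have "\<P>(\<omega> in M. \<exists>j\<le>1. a < s * X (1 * (real j * real (K * n))) \<omega> - 0 * (real j * real (K * n)))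
          = \<P>(\<omega> in M. a < s * X (real (K * n)) \<omega>)"
        using a X.start_zero by (intro arg_cong[where f=X.prob] Collect_cong) (auto simp: le_Suc_eq ex_disj_distrib conj_disj_distribR)
      also have "\<dots> \<le> 1 / 4"
        using abs_bound[of "real (K * n)" "\<lambda>x. a < s * x"] s by auto
      finally have "\<P>(\<omega> in M. \<exists>j\<le>1. a < s * X (1 * (real j * real (K * n))) \<omega> - 0 * (real j * real (K * n))) \<le> 1 / 4" .
      with ott show ?thesis by simp
    qed
    define \<xi> where "\<xi> i \<omega> = X (real (Suc i) * real n) \<omega> - X (real i * real n) \<omega>" for i \<omega>
    have "\<P>(\<omega> in M. \<forall>i<K. \<xi> i \<omega> \<in> {-4 * a..4 * a}) = (\<Prod>i<K. \<P>(\<omega> in M. X (real n) \<omega> \<in> {-4 * a..4 * a}))"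
      unfolding \<xi>_def using \<open>1 \<le> n\<close> by (intro X.incr.prob_increments) auto
    also have "\<P>(\<omega> in M. X (real n) \<omega> \<in> {-4 * a..4 * a}) = 1 - p"
    proof -
      have "\<P>(\<omega> in M. X (real n) \<omega> \<in> {-4 * a..4 * a}) = \<P>(\<omega> in M. \<not> (4 * a < \<bar>X (real n) \<omega>\<bar>))"
        by (intro arg_cong[where f=X.prob] Collect_cong) auto
      also have "\<dots> = 1 - p" unfolding p_def by (rule X.prob_neg) measurable
      finally show ?thesis .
    qed
    also have "(\<Prod>i<K. 1 - p) = (1 - p) ^ K" by simp
    finally have prod: "\<P>(\<omega> in M. \<forall>i<K. \<xi> i \<omega> \<in> {-4 * a..4 * a}) = (1 - p) ^ K" .
    let ?E = "{\<omega> \<in> space M. \<forall>i<K. \<xi> i \<omega> \<in> {-4 * a..4 * a}}"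
    let ?U = "\<lambda>s. {\<omega> \<in> space M. \<exists>t\<in>{0..real (K * n)}. 2 * a < s * X t \<omega>}"
    have "space M \<subseteq> {\<omega> \<in> space M. \<forall>i<K. \<xi> i \<omega> \<in> {-4 * a..4 * a}} \<union> (?U 1 \<union> ?U (-1))"
    proof
      fix \<omega> assume \<omega>: "\<omega> \<in> space M"
      show "\<omega> \<in> {\<omega> \<in> space M. \<forall>i<K. \<xi> i \<omega> \<in> {-4 * a..4 * a}} \<union> (?U 1 \<union> ?U (-1))"
      proof (cases "\<forall>i<K. \<xi> i \<omega> \<in> {-4 * a..4 * a}")
        case False
        then obtain i where i: "i < K" "\<xi> i \<omega> \<notin> {-4 * a..4 * a}" by blast
        have "real i * real n \<le> real K * real n" "real (Suc i) * real n \<le> real K * real n"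
          using i(1) by (auto intro!: mult_right_mono)
        then have t: "real i * real n \<in> {0..real (K * n)}" "real (Suc i) * real n \<in> {0..real (K * n)}"
          by auto
        have "2 * a < \<bar>X (real i * real n) \<omega>\<bar> \<or> 2 * a < \<bar>X (real (Suc i) * real n) \<omega>\<bar>"
          using i(2) unfolding \<xi>_def atLeastAtMost_iff by linarith
        then show ?thesis
          using \<omega> t unfolding abs_if by (auto split: if_splits simp del: of_nat_Suc)
      qed (use \<omega> in auto)
    qed
    moreover have E: "?E \<in> X.events"
    proof -
      have m: "\<xi> i \<in> borel_measurable M" for i
        unfolding \<xi>_def by (intro borel_measurable_diff X.incr.measurable_Y) auto
      have "{\<omega> \<in> space M. \<forall>i\<in>{..<K}. \<xi> i \<omega> \<in> {-4 * a..4 * a}} \<in> X.events"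
      proof (rule sets.sets_Collect_finite_All)
        fix i
        show "{\<omega> \<in> space M. \<xi> i \<omega> \<in> {-4 * a..4 * a}} \<in> X.events"
          using measurable_sets[OF m, of "{-4 * a..4 * a}" i] by (simp only: vimage_def Int_def conj_commute mem_Collect_eq) simp
      qed simp
      then show ?thesis by (simp only: Ball_def lessThan_iff)
    qed
    ultimately have "X.prob (space M) \<le> X.prob (?E \<union> (?U 1 \<union> ?U (-1)))"
      using sup[of 1] sup[of "-1"] by (intro X.finite_measure_mono sets.Un) blast+
    also have "\<dots> \<le> X.prob ?E + (X.prob (?U 1) + X.prob (?U (-1)))"
      using sup[of 1] sup[of "-1"] E
      by (intro order_trans[OF measure_Un_le] add_left_mono measure_Un_le sets.Un) blast+
    also have "\<dots> \<le> (1 - p) ^ K + (1 / 3 + 1 / 3)"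
      using sup[of 1] sup[of "-1"] prod by (intro add_mono) auto
    finally have "1 / 3 \<le> (1 - p) ^ K" by (simp add: X.prob_space)
    also have "\<dots> \<le> exp (- p) ^ K"
      using exp_ge_add_one_self[of "- p"] by (intro power_mono) (auto simp: p_def)
    also have "\<dots> = inverse (exp (p * real K))"
      by (simp add: exp_of_nat_mult[symmetric] exp_minus mult.commute power_inverse)
    finally have "exp (p * real K) \<le> 3"
      using le_imp_inverse_le[of "1 / 3" "inverse (exp (p * real K))"] by simp
    then have "p * real K \<le> 2" using exp_ge_add_one_self[of "p * real K"] by linarith
    then show ?thesis by (simp add: p_def a_def mult.assoc)
  qed
  define C where "C = 4 * (4 * A) powr (1 / \<beta>)"
  have "0 < C" using A by (simp add: C_def)
  have tail: "\<P>(\<omega> in M. y * d n < \<bar>X (real n) \<omega>\<bar>) \<le> C * y powr (- 1 / \<beta>)" if n: "n\<^sub>0 \<le> n" and y: "0 < y" for n y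
  proof -
    define z where "z = y / (4 * A)"
    have z: "0 < z" using y A by (simp add: z_def)
    have Cz: "C * y powr (- 1 / \<beta>) = 4 * z powr (- 1 / \<beta>)"
      using y A by (simp add: C_def z_def powr_divide powr_minus_divide)
    have dn: "0 < d n" using n n0 by (intro d_pos) simp
    show ?thesis
    proof (cases "z \<le> 1")
      case True
      have "1 powr (- 1 / \<beta>) \<le> z powr (- 1 / \<beta>)"
        using True z \<beta> by (intro powr_mono2') auto
      then have "1 \<le> 4 * z powr (- 1 / \<beta>)" by simp
      then show ?thesis unfolding Cz by (rule order_trans[OF X.prob_le_1])
    next
      case False
      \<comment> \<open>\<open>2 ^ k\<close> is the largest power of \<open>2\<close> for which growth guarantees \<open>4 * A * d (2 ^ k * n) \<le> y * d n\<close>\<close>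
      define \<kappa> where "\<kappa> = log 2 z / \<beta>"
      define k where "k = nat \<lfloor>\<kappa>\<rfloor>"
      have "0 \<le> \<kappa>" using False \<beta> by (simp add: \<kappa>_def zero_le_log_cancel_iff)
      then have k: "real k \<le> \<kappa>" "\<kappa> - 1 \<le> real k" unfolding k_def by linarith+
      have zk: "2 powr (\<beta> * \<kappa>) = z" using z \<beta> by (simp add: \<kappa>_def)
      have "4 * A * d (2 ^ k * n) \<le> 4 * A * (2 powr (\<beta> * real k) * d n)"
        using dyadic[OF n] A by (intro mult_left_mono) auto
      also have "\<dots> \<le> 4 * A * (z * d n)"
        unfolding zk[symmetric] using k \<beta> A dn by (intro mult_left_mono mult_right_mono powr_mono) auto
      also have "\<dots> = y * d n" using A by (simp add: z_def)
      finally have le: "4 * A * d (2 ^ k * n) \<le> y * d n" .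
      have "\<P>(\<omega> in M. y * d n < \<bar>X (real n) \<omega>\<bar>) \<le> \<P>(\<omega> in M. 4 * A * d (2 ^ k * n) < \<bar>X (real n) \<omega>\<bar>)"
        using le by (intro X.finite_measure_mono) auto
      also have "\<dots> \<le> 2 / 2 ^ k"
        using block[OF n, of "2 ^ k"] by (simp add: field_simps)
      also have "\<dots> = 2 * 2 powr (- real k)" by (simp add: powr_minus powr_realpow divide_inverse)
      also have "\<dots> \<le> 2 * 2 powr (1 - \<kappa>)" using k by (intro mult_left_mono powr_mono) auto
      also have "\<dots> = 4 * 2 powr (- \<kappa>)" by (simp add: powr_diff powr_minus divide_inverse)
      also have "2 powr (- \<kappa>) = (2 powr (\<beta> * \<kappa>)) powr (- 1 / \<beta>)"
        using \<beta> by (simp add: powr_powr)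
      also have "\<dots> = z powr (- 1 / \<beta>)" unfolding zk ..
      finally show ?thesis unfolding Cz .
    qed
  qed
  show ?thesis
  proof (rule that[OF A(1) \<open>0 < C\<close> \<beta>(1,2) n0(1) dyadic _ tail])
    show "\<P>(\<omega> in M. A * d n < \<bar>X t \<omega>\<bar>) \<le> 1 / 4" if "n\<^sub>0 \<le> n" "0 \<le> t" "t \<le> real n" for n t
      using that n0 by (intro tight) auto
  qed
qed

text \<open>
  After time \<open>2 ^ J\<close> the half line is cut into the blocks \<open>[2 ^ j, 2 ^ (j + 1)]\<close>, on which the line
  of slope \<open>b\<close> is at least \<open>b * 2 ^ j\<close>. By Ottaviani's inequality and the power tail, the process
  \<open>X (n t) / d n\<close> gets that high before the end of the block with a probability of order \<open>\<rho> ^ j\<close>,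
  where \<open>\<rho> < 1\<close> because \<open>d\<close> at the end of the block is smaller than the barrier by a factor that
  decays geometrically. The set \<open>T\<close> covers the crossing event by a countable union of measurable events.
\<close>

lemma far_tail:
  assumes "0 < b" "0 < \<eta>"
  obtains J n\<^sub>0 where "1 \<le> n\<^sub>0" "\<And>n. n\<^sub>0 \<le> n \<Longrightarrow>
    \<exists>T\<in>X.events. {\<omega> \<in> space M. \<exists>t\<ge>2 ^ J. b * t * d n < X (real n * t) \<omega>} \<subseteq> T \<and> X.prob T \<le> \<eta>"
proof -
  obtain A C \<beta> n\<^sub>0 where A: "0 < A" and C: "0 < C" and \<beta>: "0 < \<beta>" "\<beta> < 1" and n0: "1 \<le> n\<^sub>0"
    and dyadic: "\<And>n j. n\<^sub>0 \<le> n \<Longrightarrow> d (2 ^ j * n) \<le> 2 powr (\<beta> * real j) * d n"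
    and tight: "\<And>n t. n\<^sub>0 \<le> n \<Longrightarrow> 0 \<le> t \<Longrightarrow> t \<le> real n \<Longrightarrow> \<P>(\<omega> in M. A * d n < \<bar>X t \<omega>\<bar>) \<le> 1 / 4"
    and tail: "\<And>n y. n\<^sub>0 \<le> n \<Longrightarrow> 0 < y \<Longrightarrow> \<P>(\<omega> in M. y * d n < \<bar>X (real n) \<omega>\<bar>) \<le> C * y powr (- 1 / \<beta>)"
    using power_tail by blast
  \<comment> \<open>half the barrier of block \<open>j\<close> is at least \<open>c\<^sub>0 * \<theta> ^ j\<close> times the scale \<open>d (2 ^ (j + 1) * n)\<close>\<close>
  define \<theta> where "\<theta> = 2 powr (1 - \<beta>)"
  define c\<^sub>0 where "c\<^sub>0 = b / 2 * 2 powr (- \<beta>)"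
  define \<rho> where "\<rho> = \<theta> powr (- 1 / \<beta>)"
  define H where "H = 4 / 3 * C * c\<^sub>0 powr (- 1 / \<beta>)"
  have \<theta>: "1 < \<theta>" unfolding \<theta>_def using \<beta> by simp
  have c0: "0 < c\<^sub>0" using assms by (simp add: c\<^sub>0_def)
  have "\<theta> powr (- 1 / \<beta>) < \<theta> powr 0" using \<theta> \<beta> by (intro powr_less_mono) auto
  then have \<rho>: "0 < \<rho>" "\<rho> < 1" using \<theta> by (auto simp: \<rho>_def)
  define E where "E n j = {\<omega> \<in> space M. \<exists>t\<in>{0..real 1 * 2 ^ Suc j}. b * 2 ^ j * d n < X (real n * t) \<omega>}" for n j
  have block: "E n j \<in> X.events \<and> X.prob (E n j) \<le> H * \<rho> ^ j" if n: "n\<^sub>0 \<le> n" and j: "A \<le> c\<^sub>0 * \<theta> ^ j" for n j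
  proof -
    define e where "e = b / 2 * 2 ^ j * d n"
    define n' where "n' = 2 ^ Suc j * n"
    have n': "n\<^sub>0 \<le> n'" "1 \<le> n'"
      using n n0 mult_le_mono[of 1 "2 ^ Suc j" n\<^sub>0 n] mult_le_mono[of 1 "2 ^ Suc j" 1 n] by (auto simp: n'_def)
    have pos: "0 < real n" "0 < d n" "0 < d n'" using n n0 n' d_pos[of n] d_pos[of n'] by auto
    have e0: "0 < e" using assms pos by (simp add: e_def)
    have "c\<^sub>0 * \<theta> ^ j * d n' \<le> c\<^sub>0 * \<theta> ^ j * (2 powr (\<beta> * real (Suc j)) * d n)"
      unfolding n'_def using n c0 \<theta> by (intro mult_left_mono dyadic) auto
    also have "\<dots> = b / 2 * (2 powr (- \<beta>) * 2 powr ((1 - \<beta>) * real j) * 2 powr (\<beta> * real (Suc j))) * d n"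
      by (simp add: c\<^sub>0_def \<theta>_def powr_power mult.commute)
    also have "2 powr (- \<beta>) * 2 powr ((1 - \<beta>) * real j) * 2 powr (\<beta> * real (Suc j)) = 2 powr (real j)"
      by (simp add: powr_add[symmetric] algebra_simps)
    finally have ce: "c\<^sub>0 * \<theta> ^ j * d n' \<le> e" by (simp add: e_def powr_realpow)
    have "A * d n' \<le> c\<^sub>0 * \<theta> ^ j * d n'" using j pos by (intro mult_right_mono) auto
    with ce have Ae: "A * d n' \<le> e" by simp
    interpret S: increment_process M "\<lambda>t. F (real n * t)" "\<lambda>t \<omega>. 1 * X (real n * t) \<omega> - 0 * t"
      using pos by (intro X.incr.scaled)
    have m: "X t \<in> borel_measurable M" if "0 \<le> t" for t using that by (rule X.incr.measurable_Y)
    have small: "\<P>(\<omega> in M. 1 * X (real n * s) \<omega> - 0 * s < - e) \<le> 1 / 4" if s: "0 \<le> s" "s \<le> 2 ^ Suc j" for s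
    proof -
      have ns: "0 \<le> real n * s" "real n * s \<le> real n'"
        using s pos by (auto simp: n'_def mult.commute intro!: mult_right_mono)
      have [measurable]: "X (real n * s) \<in> borel_measurable M" using ns by (intro m)
      have "\<P>(\<omega> in M. 1 * X (real n * s) \<omega> - 0 * s < - e) \<le> \<P>(\<omega> in M. A * d n' < \<bar>X (real n * s) \<omega>\<bar>)"
        using Ae by (intro X.finite_measure_mono) auto
      also have "\<dots> \<le> 1 / 4" using tight[OF n'(1) ns] .
      finally show ?thesis .
    qed
    have [measurable]: "X (real n') \<in> borel_measurable M" by (intro m) simp
    have "\<P>(\<omega> in M. \<exists>i\<le>1. e < 1 * X (real n * (real i * 2 ^ Suc j)) \<omega> - 0 * (real i * 2 ^ Suc j)) = \<P>(\<omega> in M. e < X (real n') \<omega>)"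
      using e0 X.start_zero
      by (intro arg_cong[where f=X.prob] Collect_cong)
         (auto simp: le_Suc_eq ex_disj_distrib conj_disj_distribR n'_def mult.commute)
    also have "\<dots> \<le> \<P>(\<omega> in M. (c\<^sub>0 * \<theta> ^ j) * d n' < \<bar>X (real n') \<omega>\<bar>)"
      using ce by (intro X.finite_measure_mono) auto
    also have "\<dots> \<le> C * (c\<^sub>0 * \<theta> ^ j) powr (- 1 / \<beta>)"
      using n' c0 \<theta> by (intro tail) auto
    also have "(c\<^sub>0 * \<theta> ^ j) powr (- 1 / \<beta>) = c\<^sub>0 powr (- 1 / \<beta>) * \<rho> ^ j"
      using c0 \<theta> by (simp add: powr_mult \<rho>_def powr_power powr_realpow[symmetric] powr_powr mult.commute)
    finally have grid: "\<P>(\<omega> in M. \<exists>i\<le>1. e < 1 * X (real n * (real i * 2 ^ Suc j)) \<omega> - 0 * (real i * 2 ^ Suc j))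
        \<le> C * (c\<^sub>0 powr (- 1 / \<beta>) * \<rho> ^ j)" .
    have "e + e = b * 2 ^ j * d n" by (simp add: e_def)
    then have E_eq: "E n j = {\<omega> \<in> space M. \<exists>t\<in>{0..real 1 * 2 ^ Suc j}. e + e < 1 * X (real n * t) \<omega> - 0 * t}"
      by (simp add: E_def)
    have "(0::real) < 2 ^ Suc j" by simp
    note ott = S.Ottaviani[OF this small, where m=1 and x=e]
    have "X.prob (E n j) * (1 - 1 / 4) \<le> C * (c\<^sub>0 powr (- 1 / \<beta>) * \<rho> ^ j)"
      unfolding E_eq by (rule order_trans[OF ott(2) grid])
    moreover have "E n j \<in> X.events" unfolding E_eq by (rule ott(1))
    ultimately show ?thesis by (simp add: H_def)
  qed
  obtain J\<^sub>1 where "A / c\<^sub>0 < \<theta> ^ J\<^sub>1" using real_arch_pow[OF \<theta>] by blast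
  then have J1: "A \<le> c\<^sub>0 * \<theta> ^ J\<^sub>1" using c0 by (simp add: field_simps)
  have "0 < H" using C c0 by (simp add: H_def)
  have "(\<lambda>J. H * (\<rho> ^ J / (1 - \<rho>))) \<longlonglongrightarrow> H * (0 / (1 - \<rho>))"
    using \<rho> by (intro tendsto_intros LIMSEQ_realpow_zero) auto
  then have "\<forall>\<^sub>F J in sequentially. H * (\<rho> ^ J / (1 - \<rho>)) < \<eta>"
    using \<open>0 < \<eta>\<close> by (intro order_tendstoD) auto
  then obtain J where J: "J\<^sub>1 \<le> J" "H * (\<rho> ^ J / (1 - \<rho>)) < \<eta>"
    unfolding eventually_sequentially by (metis le_cases)
  have AJ: "A \<le> c\<^sub>0 * \<theta> ^ (J + i)" for i
    using J1 J(1) \<theta> c0 by (elim order_trans) (intro mult_left_mono power_increasing, auto)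
  show ?thesis
  proof (rule that[OF n0], intro bexI conjI)
    fix n assume n: "n\<^sub>0 \<le> n"
    have dn: "0 < d n" using n n0 by (intro d_pos) simp
    let ?T = "\<Union>i. E n (J + i)"
    show T: "?T \<in> X.events" using block[OF n AJ] by blast
    show "{\<omega> \<in> space M. \<exists>t\<ge>2 ^ J. b * t * d n < X (real n * t) \<omega>} \<subseteq> ?T"
    proof
      fix \<omega> assume "\<omega> \<in> {\<omega> \<in> space M. \<exists>t\<ge>2 ^ J. b * t * d n < X (real n * t) \<omega>}"
      then obtain t where t: "\<omega> \<in> space M" "2 ^ J \<le> t" "b * t * d n < X (real n * t) \<omega>" by blast
      define i where "i = (LEAST i. t < 2 ^ (J + Suc i))"
      obtain i' where "t < 2 ^ i'" using real_arch_pow[of 2 t] by auto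
      also have "(2::real) ^ i' \<le> 2 ^ (J + Suc i')" by (intro power_increasing) auto
      finally have i1: "t < 2 ^ (J + Suc i)" unfolding i_def by (rule LeastI)
      have i2: "2 ^ (J + i) \<le> t"
      proof (cases i)
        case (Suc i'')
        then have "i'' < i" by simp
        then have "\<not> t < 2 ^ (J + Suc i'')" unfolding i_def by (rule not_less_Least)
        then show ?thesis using Suc by simp
      qed (use t in simp)
      have "b * 2 ^ (J + i) * d n \<le> b * t * d n"
        using i2 assms dn by (intro mult_right_mono mult_left_mono) auto
      then have "b * 2 ^ (J + i) * d n < X (real n * t) \<omega>" using t(3) by (rule le_less_trans)
      moreover have "t \<in> {0..real 1 * 2 ^ Suc (J + i)}"
        using i1 t(2) order_trans[OF zero_le_power[of "2::real" J]] by auto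
      ultimately have "\<omega> \<in> E n (J + i)" unfolding E_def using t(1) by blast
      then show "\<omega> \<in> ?T" by blast
    qed
    have sm: "summable (\<lambda>i. H * \<rho> ^ (J + i))"
      using \<rho> by (simp add: power_add summable_mult summable_geometric)
    have le: "X.prob (E n (J + i)) \<le> H * \<rho> ^ (J + i)" for i using block[OF n AJ] by blast
    have sm': "summable (\<lambda>i. X.prob (E n (J + i)))"
      by (rule summable_comparison_test'[OF sm, of 0]) (use le in auto)
    have "X.prob ?T \<le> (\<Sum>i. X.prob (E n (J + i)))"
      using block[OF n AJ] sm' by (intro X.finite_measure_subadditive_countably) auto
    also have "\<dots> \<le> (\<Sum>i. H * \<rho> ^ (J + i))" by (rule suminf_le[OF le sm' sm])
    also have "\<dots> = H * (\<rho> ^ J / (1 - \<rho>))"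
      using \<rho> by (simp add: power_add suminf_mult suminf_geometric summable_mult summable_geometric)
    finally show "X.prob ?T \<le> \<eta>" using J(2) by simp
  qed
qed

section \<open>Convergence of the supremum\<close>

definition walk :: "nat \<Rightarrow> real \<Rightarrow> real \<Rightarrow> 'a \<Rightarrow> real" where
  "walk n c t \<omega> = 1 / d n * X (real n * t) \<omega> - c * t"

definition drifted :: "real \<Rightarrow> 'b \<Rightarrow> real" where
  "drifted t \<omega> = L t \<omega> - t"

lemma walk: "1 \<le> n \<Longrightarrow> increment_process M (\<lambda>t. F (real n * t)) (walk n c)"
  unfolding walk_def[abs_def] by (rule X.incr.scaled) simp

sublocale W: increment_process N "\<lambda>t. G (1 * t)" drifted
proof -
  have "drifted = (\<lambda>t \<omega>. 1 * L (1 * t) \<omega> - 1 * t)" by (simp add: drifted_def[abs_def])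
  then show "increment_process N (\<lambda>t. G (1 * t)) drifted" by (simp only: L.incr.scaled zero_less_one)
qed

lemma walk_weak_conv:
  assumes k: "filterlim k at_top sequentially" and c: "c \<longlonglongrightarrow> 1" and "0 \<le> t"
  shows "weak_conv_m (\<lambda>i. distr M borel (walk (k i) (c i) t)) (distr N borel (drifted t))"
proof (rule levy_continuity)
  have m: "X (real n * t) \<in> borel_measurable M" for n :: nat
    using \<open>0 \<le> t\<close> by (intro X.incr.measurable_Y) simp
  have m': "L t \<in> borel_measurable N" using \<open>0 \<le> t\<close> by (intro L.incr.measurable_Y)
  note [measurable] = m m'
  show "real_distribution (distr M borel (walk (k i) (c i) t))" for i
    unfolding walk_def by (intro X.real_distribution_distr) measurable
  show "real_distribution (distr N borel (drifted t))"
    unfolding drifted_def by (intro L.real_distribution_distr) measurable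
  fix u
  have 1: "char (distr M borel (walk (k i) (c i) t)) u =
      exp (of_real t * (of_nat (k i) * \<Psi> (u / d (k i)))) * iexp (- (u * (c i * t)))" for i
    using X.char_affine[OF m, of "1 / d (k i)" "k i" "c i * t" u] char_X[of "real (k i) * t" "u / d (k i)"] \<open>0 \<le> t\<close>
    by (simp add: walk_def[abs_def] ac_simps)
  have 2: "char (distr N borel (drifted t)) u = exp (of_real t * \<Lambda> u) * iexp (- (u * (1 * t)))"
    using L.char_affine[OF m', of 1 t u] char_L[of t u] \<open>0 \<le> t\<close>
    by (simp add: drifted_def[abs_def])
  show "(\<lambda>i. char (distr M borel (walk (k i) (c i) t)) u) \<longlonglongrightarrow> char (distr N borel (drifted t)) u"
    unfolding 1 2
    by (intro tendsto_intros exponent_tendsto[OF k tendsto_const] c)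
qed

lemma walk_grid_close:
  assumes k: "filterlim k at_top sequentially" "\<And>i. 1 \<le> k i" and c: "c \<longlonglongrightarrow> 1" and "0 \<le> \<delta>" "0 < e"
  shows "\<forall>\<^sub>F i in sequentially. \<forall>x.
    \<P>(\<omega> in M. \<exists>j\<le>m. x < walk (k i) (c i) (real j * \<delta>) \<omega>) \<le> \<P>(\<omega> in N. \<exists>j\<le>m. x - e < drifted (real j * \<delta>) \<omega>) + e \<and>
    \<P>(\<omega> in N. \<exists>j\<le>m. x < drifted (real j * \<delta>) \<omega>) \<le> \<P>(\<omega> in M. \<exists>j\<le>m. x - e < walk (k i) (c i) (real j * \<delta>) \<omega>) + e"
proof -
  interpret S: increment_process M "\<lambda>t. F (real (k i) * t)" "walk (k i) (c i)" for i
    using k(2) by (rule walk)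
  have rd: "real_distribution (distr M borel (walk (k i) (c i) \<delta>))" for i
    using S.measurable_Y[OF \<open>0 \<le> \<delta>\<close>] by (rule X.real_distribution_distr)
  have rd': "real_distribution (distr N borel (drifted \<delta>))"
    using W.measurable_Y[OF \<open>0 \<le> \<delta>\<close>] by (rule L.real_distribution_distr)
  show ?thesis
    unfolding S.prob_grid_eq[OF \<open>0 \<le> \<delta>\<close>] W.prob_grid_eq[OF \<open>0 \<le> \<delta>\<close>]
    by (rule partial_sums_weak_conv[OF rd rd' walk_weak_conv[OF k(1) c \<open>0 \<le> \<delta>\<close>] \<open>0 < e\<close>])
qed

text \<open>
  A crossing happens late, which \<open>far_tail\<close> excludes, or before time \<open>2 ^ J\<close>, where Ottaviani's
  inequality with a fine mesh \<open>\<delta>\<close> transfers it to the grid. The number of grid points and \<open>\<delta>\<close> do not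
  depend on the level, so this bound yields tightness as well as the upper half of the limit.
\<close>

lemma walk_crossing_upper:
  assumes k: "filterlim k at_top sequentially" "\<And>i. 1 \<le> k i" and c: "c \<longlonglongrightarrow> 1" and "0 < e"
  obtains \<delta> m where "0 \<le> \<delta>" "\<forall>\<^sub>F i in sequentially. \<forall>x\<ge>0. \<P>(\<omega> in M. \<exists>t\<ge>0. x < walk (k i) (c i) t \<omega>)
    \<le> \<P>(\<omega> in N. \<exists>j\<le>m. x - e < drifted (real j * \<delta>) \<omega>) + e"
proof -
  obtain J n\<^sub>1 where J: "1 \<le> n\<^sub>1" "\<And>n. n\<^sub>1 \<le> n \<Longrightarrow>
    \<exists>T\<in>X.events. {\<omega> \<in> space M. \<exists>t\<ge>2 ^ J. 1 / 2 * t * d n < X (real n * t) \<omega>} \<subseteq> T \<and> X.prob T \<le> e / 4"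
    by (rule far_tail[of "1 / 2" "e / 4"]) (use \<open>0 < e\<close> in auto)
  obtain q\<^sub>1 n\<^sub>2 where q1: "1 \<le> n\<^sub>2"
    "\<And>n s. n\<^sub>2 \<le> n \<Longrightarrow> 0 \<le> s \<Longrightarrow> s \<le> 1 / 2 ^ q\<^sub>1 \<Longrightarrow> \<P>(\<omega> in M. e / 4 * d n < \<bar>X (real n * s) \<omega>\<bar>) \<le> e / 4"
    by (rule small_times[of "e / 4" "e / 4"]) (use \<open>0 < e\<close> in auto)
  obtain q\<^sub>2 :: nat where q2: "8 / e < 2 ^ q\<^sub>2" using real_arch_pow[of 2 "8 / e"] by auto
  define q where "q = max q\<^sub>1 q\<^sub>2"
  define \<delta> :: real where "\<delta> = 1 / 2 ^ q"
  define m :: nat where "m = 2 ^ (J + q)"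
  have \<delta>: "0 < \<delta>" by (simp add: \<delta>_def)
  have "\<delta> \<le> 1 / 2 ^ q\<^sub>1" "\<delta> \<le> 1 / 2 ^ q\<^sub>2"
    unfolding \<delta>_def q_def by (auto intro!: divide_left_mono power_increasing)
  moreover have "1 / 2 ^ q\<^sub>2 < e / 8" using q2 \<open>0 < e\<close> by (simp add: field_simps)
  ultimately have \<delta>': "\<delta> \<le> 1 / 2 ^ q\<^sub>1" "2 * \<delta> \<le> e / 4" by auto
  have m\<delta>: "real m * \<delta> = 2 ^ J" by (simp add: m_def \<delta>_def power_add)
  have ev1: "\<forall>\<^sub>F i in sequentially. max n\<^sub>1 n\<^sub>2 \<le> k i" using k(1) unfolding filterlim_at_top by blast
  have ev2: "\<forall>\<^sub>F i in sequentially. 1 / 2 < c i" "\<forall>\<^sub>F i in sequentially. c i < 2"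
    by (rule order_tendstoD(1)[OF c], simp, rule order_tendstoD(2)[OF c], simp)
  have e2: "0 < e / 2" using \<open>0 < e\<close> by simp
  have ev3: "\<forall>\<^sub>F i in sequentially. \<forall>x.
    \<P>(\<omega> in M. \<exists>j\<le>m. x < walk (k i) (c i) (real j * \<delta>) \<omega>) \<le> \<P>(\<omega> in N. \<exists>j\<le>m. x - e / 2 < drifted (real j * \<delta>) \<omega>) + e / 2"
    using walk_grid_close[OF k c less_imp_le[OF \<delta>] e2, of m] by (rule eventually_mono) blast
  show ?thesis
  proof (rule that[OF less_imp_le[OF \<delta>]], use ev1 ev2 ev3 in eventually_elim, intro allI impI)
    fix i and x :: real
    assume ki: "max n\<^sub>1 n\<^sub>2 \<le> k i" and ci: "1 / 2 < c i" "c i < 2" and "0 \<le> x"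
      and close: "\<forall>x. \<P>(\<omega> in M. \<exists>j\<le>m. x < walk (k i) (c i) (real j * \<delta>) \<omega>)
        \<le> \<P>(\<omega> in N. \<exists>j\<le>m. x - e / 2 < drifted (real j * \<delta>) \<omega>) + e / 2"
    interpret S: increment_process M "\<lambda>t. F (real (k i) * t)" "walk (k i) (c i)"
      using k(2) by (rule walk)
    have dk: "0 < d (k i)" using k(2) by (rule d_pos)
    have small: "\<P>(\<omega> in M. walk (k i) (c i) s \<omega> < - (e / 2)) \<le> e / 4" if s: "0 \<le> s" "s \<le> \<delta>" for s
    proof -
      have [measurable]: "X (real (k i) * s) \<in> borel_measurable M"
        using s by (intro X.incr.measurable_Y) simp
      have "c i * s \<le> 2 * \<delta>" using s ci by (intro mult_mono) auto
      then have cs: "c i * s \<le> e / 4" using \<delta>' by simp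
      have "\<P>(\<omega> in M. walk (k i) (c i) s \<omega> < - (e / 2)) \<le> \<P>(\<omega> in M. e / 4 * d (k i) < \<bar>X (real (k i) * s) \<omega>\<bar>)"
      proof (intro X.finite_measure_mono subsetI)
        fix \<omega> assume "\<omega> \<in> {\<omega> \<in> space M. walk (k i) (c i) s \<omega> < - (e / 2)}"
        then have "\<omega> \<in> space M" "X (real (k i) * s) \<omega> / d (k i) < - (e / 4)"
          using cs by (auto simp: walk_def)
        then show "\<omega> \<in> {\<omega> \<in> space M. e / 4 * d (k i) < \<bar>X (real (k i) * s) \<omega>\<bar>}"
          using dk by (auto simp: divide_less_eq)
      qed measurable
      also have "\<dots> \<le> e / 4" using ki s \<delta>' by (intro q1) auto
      finally show ?thesis .
    qed
    let ?U = "{\<omega> \<in> space M. \<exists>t\<in>{0..real m * \<delta>}. (x - e / 2) + e / 2 < walk (k i) (c i) t \<omega>}"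
    have U: "?U \<in> X.events"
      and "X.prob ?U * (1 - e / 4) \<le> \<P>(\<omega> in M. \<exists>j\<le>m. x - e / 2 < walk (k i) (c i) (real j * \<delta>) \<omega>)"
      using S.Ottaviani[OF \<delta> small, where m=m and x="x - e / 2"] by blast+
    note this(2)
    also have "\<dots> \<le> \<P>(\<omega> in N. \<exists>j\<le>m. x - e / 2 - e / 2 < drifted (real j * \<delta>) \<omega>) + e / 2"
      using close by blast
    finally have "X.prob ?U \<le> \<P>(\<omega> in N. \<exists>j\<le>m. x - e < drifted (real j * \<delta>) \<omega>) + e / 2 + X.prob ?U * (e / 4)"
      by (simp add: algebra_simps)
    moreover have "X.prob ?U * (e / 4) \<le> 1 * (e / 4)"
      using \<open>0 < e\<close> by (intro mult_right_mono X.prob_le_1) simp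
    ultimately have PU: "X.prob ?U \<le> \<P>(\<omega> in N. \<exists>j\<le>m. x - e < drifted (real j * \<delta>) \<omega>) + 3 / 4 * e" by simp
    obtain T where T: "T \<in> X.events" "X.prob T \<le> e / 4"
      "{\<omega> \<in> space M. \<exists>t\<ge>2 ^ J. 1 / 2 * t * d (k i) < X (real (k i) * t) \<omega>} \<subseteq> T"
      using J(2)[of "k i"] ki by auto
    have "S.crossing x \<subseteq> ?U \<union> T"
    proof
      fix \<omega> assume "\<omega> \<in> S.crossing x"
      then obtain t where t: "\<omega> \<in> space M" "0 \<le> t" "x < walk (k i) (c i) t \<omega>" by blast
      show "\<omega> \<in> ?U \<union> T"
      proof (cases "t \<le> 2 ^ J")
        case True
        then have "t \<in> {0..real m * \<delta>}" using t m\<delta> by simp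
        then show ?thesis using t by auto
      next
        case False
        have "1 / 2 * t \<le> c i * t" using ci t by (intro mult_right_mono) auto
        moreover have "x < X (real (k i) * t) \<omega> / d (k i) - c i * t" using t(3) by (simp add: walk_def)
        ultimately have "1 / 2 * t < X (real (k i) * t) \<omega> / d (k i)" using \<open>0 \<le> x\<close> by linarith
        then have "1 / 2 * t * d (k i) < X (real (k i) * t) \<omega>" using dk by (simp add: less_divide_eq)
        then show ?thesis using T(3) False t(1) by force
      qed
    qed
    then have "X.prob (S.crossing x) \<le> X.prob (?U \<union> T)"
      using U T by (intro X.finite_measure_mono) auto
    also have "\<dots> \<le> X.prob ?U + X.prob T" by (rule measure_Un_le[OF U T(1)])
    also have "\<dots> \<le> \<P>(\<omega> in N. \<exists>j\<le>m. x - e < drifted (real j * \<delta>) \<omega>) + e"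
      using PU T(2) by simp
    finally show "\<P>(\<omega> in M. \<exists>t\<ge>0. x < walk (k i) (c i) t \<omega>)
      \<le> \<P>(\<omega> in N. \<exists>j\<le>m. x - e < drifted (real j * \<delta>) \<omega>) + e" .
  qed
qed

lemma walk_crossing_lower:
  assumes k: "filterlim k at_top sequentially" "\<And>i. 1 \<le> k i" and c: "c \<longlonglongrightarrow> 1" and "0 < e"
  shows "\<forall>\<^sub>F i in sequentially. L.prob (W.crossing x) \<le> \<P>(\<omega> in M. \<exists>t\<ge>0. x - e < walk (k i) (c i) t \<omega>) + e"
proof -
  have "L.prob (W.crossing x) - e / 2 < L.prob (W.crossing x)" using \<open>0 < e\<close> by simp
  from order_tendstoD(1)[OF W.crossing_grid(2) this] obtain s where
    s: "L.prob (W.crossing x) - e / 2 < \<P>(\<omega> in N. \<exists>j\<le>4 ^ s. x < drifted (real j * (1 / 2 ^ s)) \<omega>)"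
    unfolding eventually_sequentially by blast
  have "(0::real) \<le> 1 / 2 ^ s" "0 < e / 2" using \<open>0 < e\<close> by auto
  from walk_grid_close[OF k c this, of "4 ^ s"] show ?thesis
  proof eventually_elim
    case (elim i)
    interpret S: increment_process M "\<lambda>t. F (real (k i) * t)" "walk (k i) (c i)"
      using k(2) by (rule walk)
    have "L.prob (W.crossing x) - e / 2 \<le> \<P>(\<omega> in M. \<exists>j\<le>4 ^ s. x - e / 2 < walk (k i) (c i) (real j * (1 / 2 ^ s)) \<omega>) + e / 2"
      using elim[rule_format, of x] s by linarith
    also have "\<P>(\<omega> in M. \<exists>j\<le>4 ^ s. x - e / 2 < walk (k i) (c i) (real j * (1 / 2 ^ s)) \<omega>) \<le> X.prob (S.crossing (x - e / 2))"
      by (rule S.prob_grid_le_crossing) simp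
    also have "\<dots> \<le> X.prob (S.crossing (x - e))" using \<open>0 < e\<close> by (intro S.crossing_antimono) simp
    finally show ?case by simp
  qed
qed

lemma walk_crossing_tight:
  assumes k: "filterlim k at_top sequentially" "\<And>i. 1 \<le> k i" and c: "c \<longlonglongrightarrow> 1" and "0 < e"
  obtains x where "0 \<le> x" "\<forall>\<^sub>F i in sequentially. \<P>(\<omega> in M. \<exists>t\<ge>0. x < walk (k i) (c i) t \<omega>) \<le> e"
proof -
  obtain \<delta> m where \<delta>: "0 \<le> \<delta>" and up: "\<forall>\<^sub>F i in sequentially. \<forall>x\<ge>0. \<P>(\<omega> in M. \<exists>t\<ge>0. x < walk (k i) (c i) t \<omega>)
    \<le> \<P>(\<omega> in N. \<exists>j\<le>m. x - e / 2 < drifted (real j * \<delta>) \<omega>) + e / 2"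
    by (rule walk_crossing_upper[OF k c, of "e / 2"]) (use \<open>0 < e\<close> in auto)
  have "\<forall>\<^sub>F l in sequentially. \<P>(\<omega> in N. \<exists>j\<le>m. real l < drifted (real j * \<delta>) \<omega>) < e / 2"
    using \<open>0 < e\<close> by (intro order_tendstoD(2)[OF W.prob_grid_tendsto_0[OF \<delta>]]) simp
  then obtain l where l: "\<P>(\<omega> in N. \<exists>j\<le>m. real l < drifted (real j * \<delta>) \<omega>) < e / 2"
    unfolding eventually_sequentially by blast
  show ?thesis
  proof (rule that)
    show x0: "0 \<le> real l + e / 2" using \<open>0 < e\<close> by simp
    show "\<forall>\<^sub>F i in sequentially. \<P>(\<omega> in M. \<exists>t\<ge>0. real l + e / 2 < walk (k i) (c i) t \<omega>) \<le> e"
      using up by eventually_elim (use l x0 in fastforce)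
  qed
qed

text \<open>
  The tightness of the rescaled processes is inherited by their limit.
\<close>

lemma drifted_crossing_tight:
  assumes "0 < e"
  obtains x where "L.prob (W.crossing x) \<le> e"
proof -
  have k: "filterlim Suc at_top sequentially" "\<And>i. 1 \<le> Suc i" by (simp_all add: filterlim_Suc)
  have c: "(\<lambda>i::nat. 1::real) \<longlonglongrightarrow> 1" by simp
  obtain x where "\<forall>\<^sub>F i in sequentially. \<P>(\<omega> in M. \<exists>t\<ge>0. x < walk (Suc i) 1 t \<omega>) \<le> e / 2"
    by (rule walk_crossing_tight[OF k c, of "e / 2"]) (use assms in auto)
  moreover have "\<forall>\<^sub>F i in sequentially. L.prob (W.crossing (x + e / 2)) \<le> \<P>(\<omega> in M. \<exists>t\<ge>0. x + e / 2 - e / 2 < walk (Suc i) 1 t \<omega>) + e / 2"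
    using assms by (intro walk_crossing_lower[OF k c]) simp
  ultimately have "\<forall>\<^sub>F i :: nat in sequentially. L.prob (W.crossing (x + e / 2)) \<le> e"
    by eventually_elim simp
  then show ?thesis using that by simp
qed

lemma walk_crossing_tendsto:
  assumes k: "filterlim k at_top sequentially" "\<And>i. 1 \<le> k i" and c: "c \<longlonglongrightarrow> 1"
    and cont: "isCont (\<lambda>x. L.prob (W.crossing x)) x"
  shows "(\<lambda>i. \<P>(\<omega> in M. \<exists>t\<ge>0. x < walk (k i) (c i) t \<omega>)) \<longlonglongrightarrow> L.prob (W.crossing x)"
proof (cases "x < 0")
  case True
  interpret S: increment_process M "\<lambda>t. F (real (k i) * t)" "walk (k i) (c i)" for i
    using k(2) by (rule walk)
  have "S.crossing i x = space M" for i using True S.start_zero by force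
  moreover have "W.crossing x = space N" using True W.start_zero by force
  ultimately show ?thesis by (simp add: X.prob_space L.prob_space)
next
  case False
  let ?p = "\<lambda>x. L.prob (W.crossing x)"
  show ?thesis
  proof (rule tendstoI)
    fix e :: real assume "0 < e"
    then obtain h where h: "0 < h" "\<And>y. dist y x < h \<Longrightarrow> dist (?p y) (?p x) < e / 2"
      using cont unfolding continuous_at_eps_delta by (meson half_gt_zero)
    define e' where "e' = min (e / 2) (h / 2)"
    have e': "0 < e'" "e' \<le> e / 2" "e' < h" using \<open>0 < e\<close> h by (auto simp: e'_def)
    obtain \<delta> m where \<delta>: "0 \<le> \<delta>" and up: "\<forall>\<^sub>F i in sequentially. \<forall>x\<ge>0. \<P>(\<omega> in M. \<exists>t\<ge>0. x < walk (k i) (c i) t \<omega>)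
        \<le> \<P>(\<omega> in N. \<exists>j\<le>m. x - e' < drifted (real j * \<delta>) \<omega>) + e'"
      by (rule walk_crossing_upper[OF k c e'(1)])
    have "dist (?p (x - e')) (?p x) < e / 2" "dist (?p (x + e')) (?p x) < e / 2"
      by (rule h(2), use e' in \<open>simp add: dist_real_def\<close>)+
    then have p: "?p (x - e') < ?p x + e / 2" "?p x - e / 2 < ?p (x + e')"
      unfolding dist_real_def abs_less_iff by linarith+
    from up walk_crossing_lower[OF k c e'(1), of "x + e'"]
    show "\<forall>\<^sub>F i in sequentially. dist (\<P>(\<omega> in M. \<exists>t\<ge>0. x < walk (k i) (c i) t \<omega>)) (?p x) < e"
    proof eventually_elim
      case (elim i)
      have "\<P>(\<omega> in M. \<exists>t\<ge>0. x < walk (k i) (c i) t \<omega>) \<le> \<P>(\<omega> in N. \<exists>j\<le>m. x - e' < drifted (real j * \<delta>) \<omega>) + e'"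
        using elim(1) False by simp
      also have "\<dots> \<le> ?p (x - e') + e'" using W.prob_grid_le_crossing[OF \<delta>] by simp
      finally have "\<P>(\<omega> in M. \<exists>t\<ge>0. x < walk (k i) (c i) t \<omega>) < ?p x + e" using p(1) e' by linarith
      moreover have "?p x - e < \<P>(\<omega> in M. \<exists>t\<ge>0. x < walk (k i) (c i) t \<omega>)"
        using elim(2) p(2) e' by (simp del: add_diff_eq)
      ultimately show ?case by (simp add: dist_real_def abs_less_iff)
    qed
  qed
qed

text \<open>
  If \<open>n a\<close> stayed below \<open>K\<close>, then \<open>a * n a\<close> would become smaller than half of the least of
  \<open>d 1, \<dots>, d K\<close>, against \<open>a * n a / d (n a) \<rightarrow> 1\<close>.
\<close>

lemma scale_tends_to_infinity:
  assumes n: "\<And>a. 0 < a \<Longrightarrow> 1 \<le> n a" and ratio: "((\<lambda>a. (a * real (n a)) / d (n a)) \<longlongrightarrow> 1) (at_right 0)"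
  shows "filterlim n at_top (at_right 0)"
  unfolding filterlim_at_top
proof
  fix K :: nat
  define D where "D = Min (insert 1 (d ` {1..K}))"
  have D: "0 < D" unfolding D_def using d_pos by (subst Min_gr_iff) auto
  have "\<forall>\<^sub>F a in at_right 0. (1 / 2 :: real) < (a * real (n a)) / d (n a)"
    using ratio by (rule order_tendstoD) simp
  moreover have "\<forall>\<^sub>F a in at_right (0::real). 0 < a" by (rule eventually_at_right_less)
  moreover have "\<forall>\<^sub>F a in at_right (0::real). a < D / (2 * real (Suc K))"
    using D by (intro order_tendstoD(2)[OF tendsto_ident_at]) simp
  ultimately show "\<forall>\<^sub>F a in at_right 0. K \<le> n a"
  proof eventually_elim
    case (elim a)
    show "K \<le> n a"
    proof (rule ccontr)
      assume "\<not> K \<le> n a"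
      then have le: "n a \<in> {1..K}" using n[OF elim(2)] by simp
      then have "D \<le> d (n a)" unfolding D_def by (intro Min_le) auto
      moreover have "0 < d (n a)" using n[OF elim(2)] by (rule d_pos)
      then have "d (n a) / 2 < a * real (n a)" using elim(1) by (simp add: field_simps)
      moreover have "a * real (n a) \<le> D / (2 * real (Suc K)) * real (Suc K)"
        using elim le D by (intro mult_mono) auto
      moreover have "D / (2 * real (Suc K)) * real (Suc K) = D / 2" by (simp del: of_nat_Suc)
      ultimately show False by linarith
    qed
  qed
qed

lemma crossing_rescaled:
  assumes "1 \<le> n"
  shows "{\<omega> \<in> space M. \<exists>t\<ge>0. x * d n < X t \<omega> - a * t} = {\<omega> \<in> space M. \<exists>t\<ge>0. x < walk n (a * real n / d n) t \<omega>}"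
proof -
  have n: "0 < real n" "0 < d n" using assms d_pos by auto
  have eq: "x < walk n (a * real n / d n) t \<omega> \<longleftrightarrow> x * d n < X (real n * t) \<omega> - a * (real n * t)" for t \<omega>
    using n by (simp add: walk_def field_simps)
  have "(\<exists>t\<ge>0. x * d n < X t \<omega> - a * t) \<longleftrightarrow> (\<exists>t\<ge>0. x * d n < X (real n * t) \<omega> - a * (real n * t))" for \<omega>
  proof
    assume "\<exists>t\<ge>0. x * d n < X t \<omega> - a * t"
    then obtain t where "0 \<le> t" "x * d n < X t \<omega> - a * t" by blast
    then show "\<exists>t\<ge>0. x * d n < X (real n * t) \<omega> - a * (real n * t)"
      using n by (intro exI[of _ "t / real n"]) auto
  next
    assume "\<exists>t\<ge>0. x * d n < X (real n * t) \<omega> - a * (real n * t)"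
    then obtain t where "0 \<le> t" "x * d n < X (real n * t) \<omega> - a * (real n * t)" by blast
    then show "\<exists>t\<ge>0. x * d n < X t \<omega> - a * t"
      by (intro exI[of _ "real n * t"]) auto
  qed
  then show ?thesis unfolding eq by simp
qed

lemma supremum_weak_conv:
  assumes n: "\<And>a. 0 < a \<Longrightarrow> 1 \<le> n a" and ratio: "((\<lambda>a. (a * real (n a)) / d (n a)) \<longlongrightarrow> 1) (at_right 0)"
    and \<Delta>: "\<And>a. 0 < a \<Longrightarrow> \<Delta> a = 1 / d (n a)"
  shows "(\<forall>a>0. AE \<omega> in M. bdd_above ((\<lambda>t. X t \<omega> - a * t) ` {0..})) \<and>
    (AE \<omega> in N. bdd_above ((\<lambda>t. L t \<omega> - t) ` {0..})) \<and>
    weak_conv_along (\<lambda>a. distr M borel (\<lambda>\<omega>. \<Delta> a * (SUP t\<in>{0..}. X t \<omega> - a * t)))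
      (distr N borel (\<lambda>\<omega>. SUP t\<in>{0..}. L t \<omega> - t)) (at_right 0)"
proof -
  have n_inf: "filterlim n at_top (at_right 0)" using n ratio by (rule scale_tends_to_infinity)
  have seq: "filterlim (\<lambda>i. n (S i)) at_top sequentially"
      "(\<lambda>i. S i * real (n (S i)) / d (n (S i))) \<longlonglongrightarrow> 1"
    if S: "\<And>i. 0 < S i" "S \<longlonglongrightarrow> 0" for S
  proof -
    have "filterlim S (at_right 0) sequentially"
      using S(2) S(1)[THEN less_imp_neq] by (auto simp: filterlim_at S(1))
    then show "filterlim (\<lambda>i. n (S i)) at_top sequentially" "(\<lambda>i. S i * real (n (S i)) / d (n (S i))) \<longlonglongrightarrow> 1"
      by (rule filterlim_compose[OF n_inf], rule filterlim_compose[OF ratio])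
  qed
  have proc: "increment_process M (\<lambda>t. F (1 * t)) (\<lambda>t \<omega>. X t \<omega> - a * t)" for a
    using X.incr.scaled[of 1 1 a] by simp
  have tight: "\<exists>x. \<P>(\<omega> in M. \<exists>t\<ge>0. x < X t \<omega> - a * t) \<le> e" if a: "0 < a" and e: "0 < e" for a e
  proof -
    \<comment> \<open>the crossing probabilities only grow when the drift is lowered, so small drifts suffice\<close>
    define S where "S i = a / real (Suc i)" for i
    have S: "0 < S i" "S i \<le> a" for i using a by (auto simp: S_def field_simps)
    have "S \<longlonglongrightarrow> 0" unfolding S_def by (rule LIMSEQ_Suc[OF lim_const_over_n])
    note kc = seq[OF S(1) this]
    have k: "1 \<le> n (S i)" for i using S by (intro n)
    obtain x where x: "0 \<le> x" "\<forall>\<^sub>F i in sequentially. \<P>(\<omega> in M. \<exists>t\<ge>0. x < walk (n (S i)) (S i * real (n (S i)) / d (n (S i))) t \<omega>) \<le> e"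
      using walk_crossing_tight[OF kc(1) k kc(2) e] by blast
    then obtain i where i: "\<P>(\<omega> in M. \<exists>t\<ge>0. x < walk (n (S i)) (S i * real (n (S i)) / d (n (S i))) t \<omega>) \<le> e"
      unfolding eventually_sequentially by blast
    interpret Y: increment_process M "\<lambda>t. F (1 * t)" "\<lambda>t \<omega>. X t \<omega> - S i * t" by (rule proc)
    have "\<P>(\<omega> in M. \<exists>t\<ge>0. x * d (n (S i)) < X t \<omega> - a * t) \<le> \<P>(\<omega> in M. \<exists>t\<ge>0. x * d (n (S i)) < X t \<omega> - S i * t)"
    proof (rule X.finite_measure_mono[OF _ Y.crossing_grid(1)], rule subsetI)
      fix \<omega> assume "\<omega> \<in> {\<omega> \<in> space M. \<exists>t\<ge>0. x * d (n (S i)) < X t \<omega> - a * t}"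
      then obtain t where t: "\<omega> \<in> space M" "0 \<le> t" "x * d (n (S i)) < X t \<omega> - a * t" by blast
      have "S i * t \<le> a * t" using S(2) t by (intro mult_right_mono)
      then show "\<omega> \<in> {\<omega> \<in> space M. \<exists>t\<ge>0. x * d (n (S i)) < X t \<omega> - S i * t}" using t by force
    qed
    also have "\<dots> \<le> e" unfolding crossing_rescaled[OF k] by (rule i)
    finally show ?thesis by blast
  qed
  have tight': "\<exists>x. L.prob (W.crossing x) \<le> e" if "0 < e" for e
    using drifted_crossing_tight[OF that] by blast
  note supW = W.sup_over_half_line[OF tight', unfolded drifted_def]
  have supX: "AE \<omega> in M. bdd_above ((\<lambda>t. X t \<omega> - a * t) ` {0..})"
    "(\<lambda>\<omega>. SUP t\<in>{0..}. X t \<omega> - a * t) \<in> borel_measurable M"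
    "\<P>(\<omega> in M. (SUP t\<in>{0..}. X t \<omega> - a * t) \<le> x) = 1 - \<P>(\<omega> in M. \<exists>t\<ge>0. x < X t \<omega> - a * t)"
    if "0 < a" for a x
    using increment_process.sup_over_half_line[OF proc tight[OF that]] by blast+
  have cdfL: "cdf (distr N borel (\<lambda>\<omega>. SUP t\<in>{0..}. L t \<omega> - t)) x = 1 - L.prob (W.crossing x)" for x
  proof -
    have "cdf (distr N borel (\<lambda>\<omega>. SUP t\<in>{0..}. L t \<omega> - t)) x = \<P>(\<omega> in N. (SUP t\<in>{0..}. L t \<omega> - t) \<le> x)"
      unfolding cdf_def by (subst measure_distr[OF supW(2)]) (auto intro!: arg_cong[where f=L.prob])
    then show ?thesis using supW(3)[of x] by (simp add: drifted_def)
  qed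
  have cdfX: "cdf (distr M borel (\<lambda>\<omega>. \<Delta> a * (SUP t\<in>{0..}. X t \<omega> - a * t))) x =
      1 - \<P>(\<omega> in M. \<exists>t\<ge>0. x < walk (n a) (a * real (n a) / d (n a)) t \<omega>)" if a: "0 < a" for a x
  proof -
    have dn: "0 < d (n a)" using n[OF a] by (rule d_pos)
    have "(\<lambda>\<omega>. \<Delta> a * (SUP t\<in>{0..}. X t \<omega> - a * t)) \<in> borel_measurable M"
      using supX(2)[OF a] by (rule borel_measurable_times[OF borel_measurable_const])
    then have "cdf (distr M borel (\<lambda>\<omega>. \<Delta> a * (SUP t\<in>{0..}. X t \<omega> - a * t))) x
        = \<P>(\<omega> in M. \<Delta> a * (SUP t\<in>{0..}. X t \<omega> - a * t) \<le> x)"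
      unfolding cdf_def by (subst measure_distr) (auto intro!: arg_cong[where f=X.prob])
    also have "\<dots> = \<P>(\<omega> in M. (SUP t\<in>{0..}. X t \<omega> - a * t) \<le> x * d (n a))"
      unfolding \<Delta>[OF a] using dn by (simp add: divide_le_eq)
    finally show ?thesis unfolding supX(3)[OF a] crossing_rescaled[OF n[OF a]] .
  qed
  have "weak_conv_along (\<lambda>a. distr M borel (\<lambda>\<omega>. \<Delta> a * (SUP t\<in>{0..}. X t \<omega> - a * t)))
      (distr N borel (\<lambda>\<omega>. SUP t\<in>{0..}. L t \<omega> - t)) (at_right 0)"
    unfolding weak_conv_along_def
  proof (intro allI impI)
    fix x assume "isCont (cdf (distr N borel (\<lambda>\<omega>. SUP t\<in>{0..}. L t \<omega> - t))) x"
    then have "isCont (\<lambda>x. 1 - L.prob (W.crossing x)) x" unfolding cdfL[abs_def] .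
    then have "isCont (\<lambda>x. 1 - (1 - L.prob (W.crossing x))) x"
      by (rule continuous_diff[OF continuous_const])
    then have cont: "isCont (\<lambda>x. L.prob (W.crossing x)) x" by simp
    show "((\<lambda>a. cdf (distr M borel (\<lambda>\<omega>. \<Delta> a * (SUP t\<in>{0..}. X t \<omega> - a * t))) x) \<longlongrightarrow>
        cdf (distr N borel (\<lambda>\<omega>. SUP t\<in>{0..}. L t \<omega> - t)) x) (at_right 0)"
    proof (rule tendsto_at_right_sequentially[of 0 1])
      fix S :: "nat \<Rightarrow> real" assume S: "\<And>i. 0 < S i" "S \<longlonglongrightarrow> 0"
      note kc = seq[OF S]
      have k: "1 \<le> n (S i)" for i using S by (intro n)
      show "(\<lambda>i. cdf (distr M borel (\<lambda>\<omega>. \<Delta> (S i) * (SUP t\<in>{0..}. X t \<omega> - S i * t))) x)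
          \<longlonglongrightarrow> cdf (distr N borel (\<lambda>\<omega>. SUP t\<in>{0..}. L t \<omega> - t)) x"
        unfolding cdfX[OF S(1)] cdfL
        by (intro tendsto_diff tendsto_const walk_crossing_tendsto[OF kc(1) k kc(2) cont])
    qed simp
  qed
  then show ?thesis using supX(1) supW(1) by blast
qed

end

theorem proposition2:
  fixes M :: "'a measure" and F :: "real \<Rightarrow> 'a measure" and X :: "real \<Rightarrow> 'a \<Rightarrow> real"
    and N :: "'b measure" and G :: "real \<Rightarrow> 'b measure" and L :: "real \<Rightarrow> 'b \<Rightarrow> real"
    and \<alpha> :: real and d :: "nat \<Rightarrow> real" and n :: "real \<Rightarrow> nat" and \<Delta> :: "real \<Rightarrow> real"
  assumes "levy_process M F X" and "centered M X"
    and "1 < \<alpha>" and "\<alpha> \<le> 2"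
    and "stable_levy_process N G L \<alpha>"
    and "\<And>k. 1 \<le> k \<Longrightarrow> 0 < d k"
    and "weak_conv_m (\<lambda>k. distr M borel (\<lambda>\<omega>. X (real k) \<omega> / d k)) (distr N borel (L 1))"
    and "\<And>a. 0 < a \<Longrightarrow> 1 \<le> n a"
    and "((\<lambda>a. (a * real (n a)) / d (n a)) \<longlongrightarrow> 1) (at_right 0)"
    and "\<And>a. 0 < a \<Longrightarrow> \<Delta> a = 1 / d (n a)"
  shows "(\<forall>a>0. AE \<omega> in M. bdd_above ((\<lambda>t. X t \<omega> - a * t) ` {0..})) \<and>
    (AE \<omega> in N. bdd_above ((\<lambda>t. L t \<omega> - t) ` {0..})) \<and>
    weak_conv_along (\<lambda>a. distr M borel (\<lambda>\<omega>. \<Delta> a * (SUP t\<in>{0..}. X t \<omega> - a * t)))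
      (distr N borel (\<lambda>\<omega>. SUP t\<in>{0..}. L t \<omega> - t)) (at_right 0)"
proof -
  interpret X: levy_process M F X by fact
  interpret L: stable_levy_process N G L \<alpha> by fact
  obtain \<Psi> where \<Psi>: "continuous_on UNIV \<Psi>" "\<Psi> 0 = 0"
    "\<And>t u. 0 \<le> t \<Longrightarrow> char (distr M borel (X t)) u = exp (of_real t * \<Psi> u)"
    using X.exponent by blast
  obtain \<Lambda> where \<Lambda>: "continuous_on UNIV \<Lambda>" "\<Lambda> 0 = 0"
    "\<And>t u. 0 \<le> t \<Longrightarrow> char (distr N borel (L t)) u = exp (of_real t * \<Lambda> u)"
    using L.exponent by blast
  interpret attracted_levy_process M F X N G L \<alpha> d \<Psi> \<Lambda>
    by unfold_locales (use assms \<Psi> \<Lambda> in auto)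
  show ?thesis using assms(8-10) by (rule supremum_weak_conv)
qed

end
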